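(* Suppose $(M,g)$ is a compact $n$-dimensional Riemannian manifold with corners, let $\{U_i\}_{i=1}^N$ be a finite cover of $M$ by open sets each possessing a smooth embedding $\phi_i:U_i\to\mathbb{R}^{K_i}$ for some integer $K_i$, and let $V_i\subset U_i$ be another cover of $M$ where each $V_i$ is closed. Suppose $M$ supports a family of Regge metrics $\{(M,\mathcal{T}_h,g_h)\}_{h\in S}$ ($S\subset\mathbb{R}$) such that: 1. there exists $C<\infty$ such that $C_{g,g_h}(M)\,C_{g_h,g}(M)\le C$ for all $h\in S$; 2. every $n$-simplex $T$ is contained completely in $V_i$ for some index $i$; 3. for each $h\in S$ and $T\in\mathcal{T}_h$ (an $n$-simplex contained in $V_i$) there exists a one-to-one affine map $\tilde f_{h,T}:\mathbb{R}^n\to\mathbb{R}^{K_i}$ such that $\tilde f_{h,T}(\hat T)=\phi_i(T)$ (by abuse of notation, $\tilde f_{h,T}$ also denotes the linear map $v\mapsto\tilde f_{h,T}(v)-\tilde f_{h,T}(0)$); 4. there exists $0<K<\infty$ such that $$\frac{\sup_{v\ne0}\|\tilde f_{h,T}v\|/\|v\|}{\inf_{w\ne0}\|\tilde f_{h,T}w\|/\|w\|}\le K\qquad\text{for all }h\in S,\ T\in\mathcal{T}_h .$$ Then $\{(M,\mathcal{T}_h,g_h)\}_{h\in S}$ has the Riemannian shape-regularity property.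
   Context: $\hat T=\{x\in\mathbb{R}^n:\sum_i x^i\le1,\ 0\le x^i\le1\}$ is the standard simplex and $\delta$ the Euclidean metric on it. $T$ always denotes an $n$-simplex of a triangulation. Regge metrics. A smooth countable triangulation $\mathcal{T}$ of a smooth oriented $n$-manifold $M$ (possibly with corners) is a countable cover of $M$ by closed sets $\Delta$, each the image of a smooth embedding of a standard $k$-simplex for some $0\le k\le n$, such that every face of a simplex of $\mathcal{T}$ is in $\mathcal{T}$, the intersection of two simplices is empty or a face of both, and any simplex whose relative interior meets a stratum of $\partial M$ lies fully in that stratum. A Regge metric $g$ for $\mathcal{T}$ is a smooth Riemannian metric $g_\Delta$ on each $\Delta\in\mathcal{T}$ with $i_f^*g_\Delta=g_f$ for each face $f\subset\Delta$. Every smooth metric is a Regge metric. Comparison constant: $C_{g_1,g_2}(\Omega)=\operatorname*{ess\,sup}_{x\in\Omega,\ v\in T_x\Omega\setminus\{0\}}\|v\|_{g_1}/\|v\|_{g_2}$. Riemannian shape-regularity: a family of manifolds with Regge metrics $\{(M_h,\mathcal{T}_h,g_h)\}_{h\in S}$ has this property if there exist a number $0<K<\infty$ independent of $h$ and orientation-preserving diffeomorphisms $f_{h,T}:\hat T\to T$ for each $n$-simplex $T\in\mathcal{T}_h$ such that $C_{g_h,\hat\delta}(T)\,C_{\hat\delta,g_h}(T)\le K$ for all $h\in S$, $T\in\mathcal{T}_h$, where $\hat\delta=(f_{h,T}^{-1})^*\delta$. (The constant $K$ here need not equal the $K$ of condition 4.) *)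

theory Defs
  imports "HOL-Analysis.Analysis"
begin

section \<open>Smooth maps between subsets of Euclidean spaces\<close>

primrec Ck_on :: "nat \<Rightarrow> 'a::real_normed_vector set \<Rightarrow> ('a \<Rightarrow> 'b::real_normed_vector) \<Rightarrow> bool" where
  "Ck_on 0 S f \<longleftrightarrow> continuous_on S f"
| "Ck_on (Suc k) S f \<longleftrightarrow>
     (\<exists>f'. (\<forall>x\<in>S. (f has_derivative f' x) (at x)) \<and> (\<forall>v. Ck_on k S (\<lambda>x. f' x v)))"

text \<open>On a set that need not be open, smooth means locally extendable to a \<open>C\<^sup>\<infinity>\<close> map on an
  open set.\<close>

definition smooth_on :: "'a::real_normed_vector set \<Rightarrow> ('a \<Rightarrow> 'b::real_normed_vector) \<Rightarrow> bool" where
  "smooth_on S f \<longleftrightarrow>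
     (\<forall>x\<in>S. \<exists>W F. open W \<and> x \<in> W \<and> (\<forall>k. Ck_on k W F) \<and> (\<forall>y\<in>S \<inter> W. F y = f y))"

section \<open>Oriented smooth manifolds with corners\<close>

text \<open>A manifold of dimension \<open>CARD('n)\<close> is a topology together with an atlas; a chart is a pair
  of a domain and a coordinate map.\<close>

type_synonym ('a, 'n) chart = "'a set \<times> ('a \<Rightarrow> real ^ 'n)"

abbreviation cdom :: "('a, 'n) chart \<Rightarrow> 'a set" where "cdom c \<equiv> fst c"
abbreviation cmap :: "('a, 'n) chart \<Rightarrow> 'a \<Rightarrow> real ^ 'n" where "cmap c \<equiv> snd c"
abbreviation cimg :: "('a, 'n) chart \<Rightarrow> (real ^ 'n) set" where "cimg c \<equiv> cmap c ` cdom c"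
abbreviation cinv :: "('a, 'n) chart \<Rightarrow> real ^ 'n \<Rightarrow> 'a" where
  "cinv c \<equiv> inv_into (cdom c) (cmap c)"

text \<open>The model spaces are \<open>[0,\<infinity>)\<^sup>k \<times> \<real>\<^sup>n\<^sup>-\<^sup>k\<close> up to a permutation and reflections of the
  coordinates: the coordinate \<open>i\<close> is unconstrained if \<open>s $ i = 0\<close>. Reflections are allowed so that
  an oriented atlas exists also in dimension 1, where \<open>[0,1]\<close> has no oriented atlas with values in
  \<open>[0,\<infinity>)\<close> alone.\<close>

definition corner_model :: "real ^ 'n::finite \<Rightarrow> (real ^ 'n) set" where
  "corner_model s = {x. \<forall>i. 0 \<le> s $ i * x $ i}"

definition is_chart :: "'a topology \<Rightarrow> real ^ 'n::finite \<Rightarrow> ('a, 'n) chart \<Rightarrow> bool" where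
  "is_chart X s c \<longleftrightarrow>
     openin X (cdom c) \<and> openin (top_of_set (corner_model s)) (cimg c) \<and>
     homeomorphic_map (subtopology X (cdom c)) (top_of_set (cimg c)) (cmap c)"

text \<open>The change of coordinates of tangent vectors at \<open>p\<close> from the chart \<open>c\<close> to the chart \<open>c'\<close>.
  Near each of its points \<open>cimg c\<close> contains an open cone with that point as apex, so the
  derivative is unique also at boundary points.\<close>

definition chart_change ::
    "('a, 'n::finite) chart \<Rightarrow> ('a, 'n) chart \<Rightarrow> 'a \<Rightarrow> real ^ 'n \<Rightarrow> real ^ 'n" where
  "chart_change c c' p = frechet_derivative (cmap c' \<circ> cinv c) (at (cmap c p) within cimg c)"

definition oriented_manifold :: "'a topology \<Rightarrow> ('a, 'n::finite) chart set \<Rightarrow> bool" where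
  "oriented_manifold X A \<longleftrightarrow>
     Hausdorff_space X \<and> second_countable X \<and>
     (\<forall>c\<in>A. \<exists>s. is_chart X s c) \<and> (\<Union>c\<in>A. cdom c) = topspace X \<and>
     (\<forall>c\<in>A. \<forall>c'\<in>A. smooth_on (cmap c ` (cdom c \<inter> cdom c')) (cmap c' \<circ> cinv c) \<and>
        (\<forall>p\<in>cdom c \<inter> cdom c'. 0 < det (matrix (chart_change c c' p))))"

text \<open>The points lying on exactly \<open>j\<close> of the local boundary hypersurfaces.\<close>

definition depth_set :: "'a topology \<Rightarrow> ('a, 'n::finite) chart set \<Rightarrow> nat \<Rightarrow> 'a set" where
  "depth_set X A j =
     {p. \<exists>c\<in>A. \<exists>s. is_chart X s c \<and> p \<in> cdom c \<and> card {i. s $ i \<noteq> 0 \<and> cmap c p $ i = 0} = j}"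

text \<open>Strata of the boundary are closed here (a closed simplex having vertices of the manifold
  as vertices does not lie in an open stratum).\<close>

definition boundary_strata :: "'a topology \<Rightarrow> ('a, 'n::finite) chart set \<Rightarrow> 'a set set" where
  "boundary_strata X A =
     {X closure_of Z | Z j. 1 \<le> j \<and> Z \<in> connected_components_of (subtopology X (depth_set X A j))}"

section \<open>Riemannian metrics\<close>

text \<open>Tangent vectors at \<open>p\<close> are written in the coordinates of a chart \<open>c\<close> around \<open>p\<close>, and a field
  of bilinear forms is given by its components \<open>g c p\<close>; the transformation law between charts is
  part of the definition of a metric.\<close>

type_synonym ('a, 'n) form_field =
  "('a, 'n) chart \<Rightarrow> 'a \<Rightarrow> real ^ 'n \<Rightarrow> real ^ 'n \<Rightarrow> real"

definition inner_product_on :: "'v::real_vector set \<Rightarrow> ('v \<Rightarrow> 'v \<Rightarrow> real) \<Rightarrow> bool" where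
  "inner_product_on W B \<longleftrightarrow>
     (\<forall>u\<in>W. \<forall>v\<in>W. \<forall>w\<in>W. \<forall>a b. B (a *\<^sub>R u + b *\<^sub>R v) w = a * B u w + b * B v w) \<and>
     (\<forall>u\<in>W. \<forall>v\<in>W. B u v = B v u) \<and> (\<forall>u\<in>W. u \<noteq> 0 \<longrightarrow> 0 < B u u)"

definition riemannian_metric :: "('a, 'n::finite) chart set \<Rightarrow> ('a, 'n) form_field \<Rightarrow> bool" where
  "riemannian_metric A g \<longleftrightarrow>
     (\<forall>c\<in>A. \<forall>p\<in>cdom c. inner_product_on UNIV (g c p)) \<and>
     (\<forall>c\<in>A. \<forall>u v. smooth_on (cimg c) (\<lambda>x. g c (cinv c x) u v)) \<and>
     (\<forall>c\<in>A. \<forall>c'\<in>A. \<forall>p\<in>cdom c \<inter> cdom c'. \<forall>u v.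
        g c' p (chart_change c c' p u) (chart_change c c' p v) = g c p u v)"

section \<open>Smooth embeddings\<close>

definition smooth_into ::
    "'a topology \<Rightarrow> ('a, 'n::finite) chart set \<Rightarrow> (real ^ 'n) set \<Rightarrow> (real ^ 'n \<Rightarrow> 'a) \<Rightarrow> bool" where
  "smooth_into X A \<Omega> f \<longleftrightarrow>
     continuous_map (top_of_set \<Omega>) X f \<and>
     (\<forall>c\<in>A. smooth_on {x\<in>\<Omega>. f x \<in> cdom c} (cmap c \<circ> f))"

definition tangent_map ::
    "('a, 'n::finite) chart \<Rightarrow> (real ^ 'n) set \<Rightarrow> (real ^ 'n \<Rightarrow> 'a) \<Rightarrow> real ^ 'n \<Rightarrow> real ^ 'n \<Rightarrow> real ^ 'n"
  where "tangent_map c \<Omega> f x = frechet_derivative (cmap c \<circ> f) (at x within \<Omega>)"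

text \<open>Smooth embeddings of an open subset \<open>U\<close> of the manifold into \<open>\<real>\<^sup>k\<close>, the latter being the
  library's \<^term>\<open>Euclidean_space k\<close> (sequences vanishing from index \<open>k\<close> on), so that \<open>k\<close> is a
  natural number and not a type.\<close>

definition smooth_embedding ::
    "'a topology \<Rightarrow> ('a, 'n::finite) chart set \<Rightarrow> 'a set \<Rightarrow> nat \<Rightarrow> ('a \<Rightarrow> nat \<Rightarrow> real) \<Rightarrow> bool" where
  "smooth_embedding X A U k \<phi> \<longleftrightarrow>
     embedding_map (subtopology X U) (Euclidean_space k) \<phi> \<and>
     (\<forall>c\<in>A. \<forall>j<k. smooth_on (cmap c ` (U \<inter> cdom c)) (\<lambda>x. \<phi> (cinv c x) j)) \<and>
     (\<forall>c\<in>A. \<forall>p\<in>U \<inter> cdom c. \<forall>v.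
        (\<forall>j<k. frechet_derivative (\<lambda>x. \<phi> (cinv c x) j)
                 (at (cmap c p) within cmap c ` (U \<inter> cdom c)) v = 0) \<longrightarrow> v = 0)"

definition affine_into :: "nat \<Rightarrow> ('v::real_vector \<Rightarrow> nat \<Rightarrow> real) \<Rightarrow> bool" where
  "affine_into k F \<longleftrightarrow>
     range F \<subseteq> topspace (Euclidean_space k) \<and> (\<forall>j. linear (\<lambda>v. F v j - F 0 j))"

text \<open>The Euclidean norm of \<open>F v - F 0\<close> in \<open>\<real>\<^sup>k\<close>, relative to that of \<open>v\<close>.\<close>

definition linear_stretch ::
    "nat \<Rightarrow> ('v::real_normed_vector \<Rightarrow> nat \<Rightarrow> real) \<Rightarrow> 'v \<Rightarrow> real" where
  "linear_stretch k F v = L2_set (\<lambda>j. F v j - F 0 j) {..<k} / norm v"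

section \<open>Triangulations\<close>

text \<open>The standard simplex of dimension \<open>card I\<close>, placed in the coordinate subspace of \<open>\<real>\<^sup>n\<close>
  belonging to \<open>I\<close>; for \<open>I = UNIV\<close> it is the standard \<open>n\<close>-simplex.\<close>

definition coord_space :: "'n set \<Rightarrow> (real ^ 'n::finite) set" where
  "coord_space I = {x. \<forall>i. i \<notin> I \<longrightarrow> x $ i = 0}"

definition std_simplex :: "'n set \<Rightarrow> (real ^ 'n::finite) set" where
  "std_simplex I = {x \<in> coord_space I. (\<Sum>i\<in>UNIV. x $ i) \<le> 1 \<and> (\<forall>i. 0 \<le> x $ i \<and> x $ i \<le> 1)}"

text \<open>\<open>\<sigma>\<close> is a smooth embedding of the standard simplex with image \<open>\<Delta>\<close>. A derivative within
  \<^term>\<open>std_simplex I\<close> is determined on \<^term>\<open>coord_space I\<close> only, and is only applied to vectors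
  from there.\<close>

definition simplex_param ::
    "'a topology \<Rightarrow> ('a, 'n::finite) chart set \<Rightarrow> 'n set \<Rightarrow> (real ^ 'n \<Rightarrow> 'a) \<Rightarrow> 'a set \<Rightarrow> bool" where
  "simplex_param X A I \<sigma> \<Delta> \<longleftrightarrow>
     embedding_map (top_of_set (std_simplex I)) X \<sigma> \<and>
     smooth_into X A (std_simplex I) \<sigma> \<and>
     (\<forall>x\<in>std_simplex I. \<forall>c\<in>A. \<sigma> x \<in> cdom c \<longrightarrow>
        inj_on (tangent_map c (std_simplex I) \<sigma> x) (coord_space I)) \<and>
     \<sigma> ` std_simplex I = \<Delta>"

text \<open>Faces do not depend on the choice of \<open>\<sigma>\<close>: a diffeomorphism between standard simplices
  maps faces to faces.\<close>

definition simplex_face ::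
    "'a topology \<Rightarrow> ('a, 'n::finite) chart set \<Rightarrow> 'a set \<Rightarrow> 'a set \<Rightarrow> bool" where
  "simplex_face X A F \<Delta> \<longleftrightarrow>
     (\<exists>I \<sigma> E. simplex_param X A I \<sigma> \<Delta> \<and> E face_of std_simplex I \<and> E \<noteq> {} \<and> F = \<sigma> ` E)"

definition triangulation ::
    "'a topology \<Rightarrow> ('a, 'n::finite) chart set \<Rightarrow> 'a set set \<Rightarrow> bool" where
  "triangulation X A \<T> \<longleftrightarrow>
     countable \<T> \<and> \<Union>\<T> = topspace X \<and>
     (\<forall>\<Delta>\<in>\<T>. closedin X \<Delta> \<and> (\<exists>I \<sigma>. simplex_param X A I \<sigma> \<Delta>)) \<and>
     (\<forall>\<Delta>\<in>\<T>. \<forall>F. simplex_face X A F \<Delta> \<longrightarrow> F \<in> \<T>) \<and>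
     (\<forall>\<Delta>\<in>\<T>. \<forall>\<Delta>'\<in>\<T>. \<Delta> \<inter> \<Delta>' = {} \<or>
        simplex_face X A (\<Delta> \<inter> \<Delta>') \<Delta> \<and> simplex_face X A (\<Delta> \<inter> \<Delta>') \<Delta>') \<and>
     (\<forall>\<Delta>\<in>\<T>. \<forall>I \<sigma>. \<forall>Z\<in>boundary_strata X A.
        simplex_param X A I \<sigma> \<Delta> \<and> \<sigma> ` rel_interior (std_simplex I) \<inter> Z \<noteq> {} \<longrightarrow> \<Delta> \<subseteq> Z)"

definition top_simplices ::
    "'a topology \<Rightarrow> ('a, 'n::finite) chart set \<Rightarrow> 'a set set \<Rightarrow> 'a set set" where
  "top_simplices X A \<T> = {T\<in>\<T>. \<exists>\<sigma>. simplex_param X A UNIV \<sigma> T}"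

section \<open>Regge metrics\<close>

text \<open>The tangent space of \<open>\<Delta>\<close> at \<open>p\<close>, in the coordinates of \<open>c\<close>; all parametrizations of \<open>\<Delta>\<close>
  give the same subspace.\<close>

definition simplex_tangent ::
    "'a topology \<Rightarrow> ('a, 'n::finite) chart set \<Rightarrow> 'a set \<Rightarrow> ('a, 'n) chart \<Rightarrow> 'a \<Rightarrow> (real ^ 'n) set" where
  "simplex_tangent X A \<Delta> c p =
     {tangent_map c (std_simplex I) \<sigma> x u | I \<sigma> x u.
        simplex_param X A I \<sigma> \<Delta> \<and> x \<in> std_simplex I \<and> \<sigma> x = p \<and> u \<in> coord_space I}"

definition simplex_metric ::
    "'a topology \<Rightarrow> ('a, 'n::finite) chart set \<Rightarrow> 'a set \<Rightarrow> ('a, 'n) form_field \<Rightarrow> bool" where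
  "simplex_metric X A \<Delta> g \<longleftrightarrow>
     (\<forall>c\<in>A. \<forall>p\<in>\<Delta> \<inter> cdom c. inner_product_on (simplex_tangent X A \<Delta> c p) (g c p)) \<and>
     (\<forall>I \<sigma>. simplex_param X A I \<sigma> \<Delta> \<longrightarrow>
        (\<forall>c\<in>A. \<forall>u\<in>coord_space I. \<forall>v\<in>coord_space I.
           smooth_on {x\<in>std_simplex I. \<sigma> x \<in> cdom c}
             (\<lambda>x. g c (\<sigma> x) (tangent_map c (std_simplex I) \<sigma> x u)
                             (tangent_map c (std_simplex I) \<sigma> x v)))) \<and>
     (\<forall>c\<in>A. \<forall>c'\<in>A. \<forall>p\<in>\<Delta> \<inter> cdom c \<inter> cdom c'.
        \<forall>u\<in>simplex_tangent X A \<Delta> c p. \<forall>v\<in>simplex_tangent X A \<Delta> c p.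
          g c' p (chart_change c c' p u) (chart_change c c' p v) = g c p u v)"

text \<open>\<open>G \<Delta>\<close> is the metric on \<open>\<Delta>\<close>.\<close>

definition regge_metric ::
    "'a topology \<Rightarrow> ('a, 'n::finite) chart set \<Rightarrow> 'a set set \<Rightarrow> ('a set \<Rightarrow> ('a, 'n) form_field) \<Rightarrow> bool"
  where
  "regge_metric X A \<T> G \<longleftrightarrow>
     (\<forall>\<Delta>\<in>\<T>. simplex_metric X A \<Delta> (G \<Delta>)) \<and>
     (\<forall>\<Delta>\<in>\<T>. \<forall>F. simplex_face X A F \<Delta> \<longrightarrow>
        (\<forall>c\<in>A. \<forall>p\<in>F \<inter> cdom c. \<forall>u\<in>simplex_tangent X A F c p. \<forall>v\<in>simplex_tangent X A F c p.
           G \<Delta> c p u v = G F c p u v))"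

text \<open>A Regge metric as an almost everywhere defined field on the manifold: the choice of \<open>T\<close> is
  forced outside the boundaries of the \<open>n\<close>-simplices, which form a null set.\<close>

definition regge_field ::
    "'a topology \<Rightarrow> ('a, 'n::finite) chart set \<Rightarrow> 'a set set \<Rightarrow> ('a set \<Rightarrow> ('a, 'n) form_field)
       \<Rightarrow> ('a, 'n) form_field" where
  "regge_field X A \<T> G c p = G (SOME T. T \<in> top_simplices X A \<T> \<and> p \<in> T) c p"

section \<open>Comparison constants and shape-regularity\<close>

definition null_set :: "('a, 'n::finite) chart set \<Rightarrow> 'a set \<Rightarrow> bool" where
  "null_set A N \<longleftrightarrow> (\<forall>c\<in>A. negligible (cmap c ` (N \<inter> cdom c)))"

text \<open>The essential supremum over \<open>p \<in> \<Omega>\<close> of the supremum over tangent vectors \<open>v \<noteq> 0\<close> at \<open>p\<close>;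
  the latter does not depend on the chart.\<close>

definition comparison_const ::
    "('a, 'n::finite) chart set \<Rightarrow> ('a, 'n) form_field \<Rightarrow> ('a, 'n) form_field \<Rightarrow> 'a set \<Rightarrow> ennreal" where
  "comparison_const A g1 g2 \<Omega> =
     Inf {b. null_set A {p\<in>\<Omega>. \<exists>c\<in>A. p \<in> cdom c \<and>
                (\<exists>v. v \<noteq> 0 \<and> b < ennreal (sqrt (g1 c p v v) / sqrt (g2 c p v v)))}}"

text \<open>\<open>f\<close> is a diffeomorphism from the standard \<open>n\<close>-simplex onto \<open>T\<close>, preserving orientation.\<close>

definition oriented_diffeo ::
    "'a topology \<Rightarrow> ('a, 'n::finite) chart set \<Rightarrow> (real ^ 'n \<Rightarrow> 'a) \<Rightarrow> 'a set \<Rightarrow> bool" where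
  "oriented_diffeo X A f T \<longleftrightarrow>
     bij_betw f (std_simplex UNIV) T \<and> smooth_into X A (std_simplex UNIV) f \<and>
     (\<forall>c\<in>A. smooth_on (cmap c ` (T \<inter> cdom c)) (inv_into (std_simplex UNIV) f \<circ> cinv c)) \<and>
     (\<forall>x\<in>std_simplex UNIV. \<forall>c\<in>A. f x \<in> cdom c \<longrightarrow>
        0 < det (matrix (tangent_map c (std_simplex UNIV) f x)))"

text \<open>The pullback of the Euclidean metric along \<open>f\<^sup>-\<^sup>1 : T \<rightarrow> std_simplex UNIV\<close>.\<close>

definition pushed_euclidean ::
    "(real ^ 'n \<Rightarrow> 'a) \<Rightarrow> 'a set \<Rightarrow> ('a, 'n::finite) form_field" where
  "pushed_euclidean f T c p u v =
     (let D = frechet_derivative (inv_into (std_simplex UNIV) f \<circ> cinv c)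
                (at (cmap c p) within cmap c ` (T \<inter> cdom c))
      in D u \<bullet> D v)"

definition regge_family ::
    "'h set \<Rightarrow> ('h \<Rightarrow> 'a topology) \<Rightarrow> ('h \<Rightarrow> ('a, 'n::finite) chart set) \<Rightarrow> ('h \<Rightarrow> 'a set set)
       \<Rightarrow> ('h \<Rightarrow> 'a set \<Rightarrow> ('a, 'n) form_field) \<Rightarrow> bool" where
  "regge_family S X A \<T> G \<longleftrightarrow>
     (\<forall>h\<in>S. oriented_manifold (X h) (A h) \<and> triangulation (X h) (A h) (\<T> h) \<and>
             regge_metric (X h) (A h) (\<T> h) (G h))"

definition riemannian_shape_regular ::
    "'h set \<Rightarrow> ('h \<Rightarrow> 'a topology) \<Rightarrow> ('h \<Rightarrow> ('a, 'n::finite) chart set) \<Rightarrow> ('h \<Rightarrow> 'a set set)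
       \<Rightarrow> ('h \<Rightarrow> 'a set \<Rightarrow> ('a, 'n) form_field) \<Rightarrow> bool" where
  "riemannian_shape_regular S X A \<T> G \<longleftrightarrow>
     regge_family S X A \<T> G \<and>
     (\<exists>K f. 0 < K \<and> K < \<infinity> \<and>
        (\<forall>h\<in>S. \<forall>T\<in>top_simplices (X h) (A h) (\<T> h).
           oriented_diffeo (X h) (A h) (f h T) T \<and>
           comparison_const (A h) (regge_field (X h) (A h) (\<T> h) (G h))
               (pushed_euclidean (f h T) T) T *
           comparison_const (A h) (pushed_euclidean (f h T) T)
               (regge_field (X h) (A h) (\<T> h) (G h)) T \<le> K))"

end

theory Submission
  imports Defs
begin

text \<open>
  The diffeomorphism from the standard simplex to an \<open>n\<close>-simplex \<open>T \<subseteq> V\<^sub>i\<close> is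
  \<open>f = (\<phi>\<^sub>i restricted to T)\<^sup>-\<^sup>1 \<circ> F\<close>, where \<open>F\<close> is the affine map onto \<open>\<phi>\<^sub>i(T)\<close>. Since
  \<open>\<phi>\<^sub>i \<circ> f = F\<close>, a tangent vector \<open>v = df(w)\<close> satisfies \<open>d\<phi>\<^sub>i(v) = Fw\<close>, with \<open>F\<close> also denoting
  its linear part, while its length in the metric pushed forward by \<open>f\<close> is \<open>\<bar>w\<bar>\<close>. Three
  comparisons bound the distortion of \<open>f\<close>:

  \<^item> \<open>\<bar>v\<bar>\<^sub>g\<close> against \<open>\<bar>d\<phi>\<^sub>i(v)\<bar>\<close>. Both are Riemannian norms near the compact set \<open>V\<^sub>i\<close>, hence
    equivalent there with a constant depending on \<open>i\<close> only (\<open>comparable_on_compact\<close>).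

  \<^item> \<open>\<bar>Fw\<bar>\<close> against \<open>\<bar>w\<bar>\<close>. The ratio lies between \<open>a > 0\<close> and \<open>b \<le> K a\<close>
    (\<open>affine_stretch_bounds\<close>). The numbers \<open>a\<close> and \<open>b\<close> depend on the size of \<open>T\<close>, but in the
    product of the two comparison constants only the quotient \<open>b / a\<close> survives.

  \<^item> \<open>g\<^sub>h\<close> against \<open>g\<close>, where the product of the comparison constants is bounded by hypothesis.

  Smoothness of \<open>f\<close> comes from the inverse function theorem: composing \<open>\<phi>\<^sub>i\<close> with a linear left
  inverse of its derivative at a point gives a local diffeomorphism of \<open>\<real>\<^sup>n\<close>, which expresses a
  chart as a smooth function of \<open>\<phi>\<^sub>i\<close> and thus \<open>f\<close> as a smooth function of \<open>F\<close>
  (\<open>chart_from_embedding\<close>).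

  The map \<open>f\<close> may reverse the orientation. By connectedness of the simplex it does so everywhere
  or nowhere (\<open>tangent_map_orientation\<close>). In the former case it is composed with the affine
  involution of the standard simplex that exchanges the origin with one other vertex; this has
  determinant \<open>-1\<close> and costs a factor depending on the dimension only.
\<close>

section \<open>Calculus of \<open>C\<^sup>k\<close> maps\<close>

lemma Ck_on_continuous: "Ck_on k S f \<Longrightarrow> continuous_on S f"
  by (cases k) (auto intro: continuous_at_imp_continuous_on has_derivative_continuous)

lemma Ck_on_SucI:
  assumes "\<And>x. x \<in> S \<Longrightarrow> (f has_derivative f' x) (at x)" and "\<And>v. Ck_on k S (\<lambda>x. f' x v)"
  shows "Ck_on (Suc k) S f"
  using assms by auto

lemma Ck_on_SucE:
  assumes "Ck_on (Suc k) S f"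
  obtains f' where "\<And>x. x \<in> S \<Longrightarrow> (f has_derivative f' x) (at x)" and "\<And>v. Ck_on k S (\<lambda>x. f' x v)"
  using assms by auto

lemma Ck_on_SucD: "Ck_on (Suc k) S f \<Longrightarrow> Ck_on k S f"
proof (induction k arbitrary: f)
  case 0
  then show ?case using Ck_on_continuous[of "Suc 0"] by simp
next
  case (Suc k)
  then show ?case by (metis Ck_on.simps(2))
qed

lemma Ck_on_subset: "Ck_on k S f \<Longrightarrow> T \<subseteq> S \<Longrightarrow> Ck_on k T f"
proof (induction k arbitrary: f)
  case 0
  then show ?case using continuous_on_subset by auto
next
  case (Suc k)
  then show ?case by (simp; blast)
qed

lemma Ck_on_cong:
  assumes "open S" and "Ck_on k S f" and "\<And>x. x \<in> S \<Longrightarrow> f x = g x"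
  shows "Ck_on k S g"
proof (cases k)
  case 0
  then show ?thesis using assms continuous_on_cong by fastforce
next
  case (Suc m)
  then obtain f' where f': "\<And>x. x \<in> S \<Longrightarrow> (f has_derivative f' x) (at x)"
    "\<And>v. Ck_on m S (\<lambda>x. f' x v)" using assms by auto
  have "(g has_derivative f' x) (at x)" if "x \<in> S" for x
    using has_derivative_transform_within_open[OF f'(1)[OF that] assms(1) that] assms(3) by auto
  with f'(2) Suc show ?thesis by auto
qed

lemma Ck_on_const: "Ck_on k S (\<lambda>x. c)"
proof (induction k arbitrary: c)
  case (Suc k)
  show ?case by (intro Ck_on_SucI[of _ _ "\<lambda>x v. 0"] has_derivative_const Suc)
qed simp

lemma Ck_on_add: "Ck_on k S f \<Longrightarrow> Ck_on k S g \<Longrightarrow> Ck_on k S (\<lambda>x. f x + g x)"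
proof (induction k arbitrary: f g)
  case 0
  then show ?case by (auto intro: continuous_on_add)
next
  case (Suc k)
  from Suc.prems(1) obtain f' where f':
    "\<And>x. x \<in> S \<Longrightarrow> (f has_derivative f' x) (at x)" "\<And>v. Ck_on k S (\<lambda>x. f' x v)"
    by (rule Ck_on_SucE) blast
  from Suc.prems(2) obtain g' where g':
    "\<And>x. x \<in> S \<Longrightarrow> (g has_derivative g' x) (at x)" "\<And>v. Ck_on k S (\<lambda>x. g' x v)"
    by (rule Ck_on_SucE) blast
  show ?case
    by (intro Ck_on_SucI[of S _ "\<lambda>x v. f' x v + g' x v"] has_derivative_add Suc.IH f' g')
qed

lemma Ck_on_sum:
  "(\<And>i. i \<in> I \<Longrightarrow> Ck_on k S (f i)) \<Longrightarrow> Ck_on k S (\<lambda>x. \<Sum>i\<in>I. f i x)"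
  by (induction I rule: infinite_finite_induct) (auto intro: Ck_on_const Ck_on_add)

lemma Ck_on_scaleR:
  fixes f :: "'a::real_normed_vector \<Rightarrow> real"
  shows "Ck_on k S f \<Longrightarrow> Ck_on k S g \<Longrightarrow> Ck_on k S (\<lambda>x. f x *\<^sub>R g x)"
proof (induction k arbitrary: f g)
  case 0
  then show ?case by (auto intro: continuous_on_scaleR)
next
  case (Suc k)
  from Suc.prems(1) obtain f' where f':
    "\<And>x. x \<in> S \<Longrightarrow> (f has_derivative f' x) (at x)" "\<And>v. Ck_on k S (\<lambda>x. f' x v)"
    by (rule Ck_on_SucE) blast
  from Suc.prems(2) obtain g' where g':
    "\<And>x. x \<in> S \<Longrightarrow> (g has_derivative g' x) (at x)" "\<And>v. Ck_on k S (\<lambda>x. g' x v)"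
    by (rule Ck_on_SucE) blast
  have "Ck_on k S f" "Ck_on k S g" using Suc.prems Ck_on_SucD by blast+
  then show ?case
    by (intro Ck_on_SucI[of S _ "\<lambda>x v. f x *\<^sub>R g' x v + f' x v *\<^sub>R g x"] has_derivative_scaleR
        Ck_on_add Suc.IH f' g')
qed

lemma Ck_on_mult:
  fixes f g :: "'a::real_normed_vector \<Rightarrow> real"
  shows "Ck_on k S f \<Longrightarrow> Ck_on k S g \<Longrightarrow> Ck_on k S (\<lambda>x. f x * g x)"
  using Ck_on_scaleR[of k S f g] by simp

lemma Ck_on_prod:
  fixes f :: "'i \<Rightarrow> 'a::real_normed_vector \<Rightarrow> real"
  shows "(\<And>i. i \<in> I \<Longrightarrow> Ck_on k S (f i)) \<Longrightarrow> Ck_on k S (\<lambda>x. \<Prod>i\<in>I. f i x)"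
  by (induction I rule: infinite_finite_induct) (auto intro: Ck_on_const Ck_on_mult)

lemma Ck_on_inverse:
  fixes f :: "'a::real_normed_vector \<Rightarrow> real"
  shows "Ck_on k S f \<Longrightarrow> (\<And>x. x \<in> S \<Longrightarrow> f x \<noteq> 0) \<Longrightarrow> Ck_on k S (\<lambda>x. inverse (f x))"
proof (induction k arbitrary: f)
  case 0
  then show ?case by (auto intro: continuous_on_inverse)
next
  case (Suc k)
  from Suc.prems(1) obtain f' where f':
    "\<And>x. x \<in> S \<Longrightarrow> (f has_derivative f' x) (at x)" "\<And>v. Ck_on k S (\<lambda>x. f' x v)"
    by (rule Ck_on_SucE) blast
  have inv: "Ck_on k S (\<lambda>x. inverse (f x))" using Suc Ck_on_SucD by blast
  have "((\<lambda>x. inverse (f x)) has_derivative (\<lambda>v. (-1) * (inverse (f x) * f' x v * inverse (f x)))) (at x)"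
    if "x \<in> S" for x
    using Deriv.has_derivative_inverse[OF Suc.prems(2)[OF that] f'(1)[OF that]] by simp
  moreover have "Ck_on k S (\<lambda>x. (-1) * (inverse (f x) * f' x v * inverse (f x)))" for v
    by (intro Ck_on_mult Ck_on_const inv f')
  ultimately show ?case by (rule Ck_on_SucI)
qed

lemma Ck_on_bounded_linear: "bounded_linear L \<Longrightarrow> Ck_on k S L"
  by (cases k) (auto intro: linear_continuous_on simp del: Ck_on.simps(2)
      intro!: Ck_on_SucI[of _ _ "\<lambda>_. L"] Ck_on_const bounded_linear_imp_has_derivative)

lemma Ck_on_linear_image: "bounded_linear L \<Longrightarrow> Ck_on k S f \<Longrightarrow> Ck_on k S (\<lambda>x. L (f x))"
proof (induction k arbitrary: f)
  case 0
  then show ?case by (auto intro: bounded_linear.continuous_on)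
next
  case (Suc k)
  from Suc.prems(2) obtain f' where f':
    "\<And>x. x \<in> S \<Longrightarrow> (f has_derivative f' x) (at x)" "\<And>v. Ck_on k S (\<lambda>x. f' x v)"
    by (rule Ck_on_SucE) blast
  show ?case
    by (intro Ck_on_SucI[of _ _ "\<lambda>x v. L (f' x v)"] bounded_linear.has_derivative[of L] Suc f')
qed

text \<open>The derivative \<open>g' (f x) (f' x v)\<close> depends on \<open>x\<close> also through the vector inserted into
  \<open>g'\<close>, whereas \<^const>\<open>Ck_on\<close> speaks of derivatives in constant directions. Expanding
  \<open>f' x v\<close> in an orthonormal basis reduces it to constant directions, products and sums.\<close>

lemma Ck_on_compose:
  fixes f :: "'a::real_normed_vector \<Rightarrow> 'b::euclidean_space" and g :: "'b \<Rightarrow> 'c::real_normed_vector"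
  assumes "f ` S \<subseteq> T" and "Ck_on k S f" and "Ck_on k T g"
  shows "Ck_on k S (\<lambda>x. g (f x))"
  using assms
proof (induction k arbitrary: f g)
  case 0
  then show ?case using continuous_on_compose2[of T g S f] by simp
next
  case (Suc k)
  from Suc.prems(2) obtain f' where f':
    "\<And>x. x \<in> S \<Longrightarrow> (f has_derivative f' x) (at x)" "\<And>v. Ck_on k S (\<lambda>x. f' x v)"
    by (rule Ck_on_SucE) blast
  from Suc.prems(3) obtain g' where g':
    "\<And>x. x \<in> T \<Longrightarrow> (g has_derivative g' x) (at x)" "\<And>v. Ck_on k T (\<lambda>x. g' x v)"
    by (rule Ck_on_SucE) blast
  define h' where "h' = (\<lambda>x v. \<Sum>b\<in>Basis. (f' x v \<bullet> b) *\<^sub>R g' (f x) b)"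
  have "((\<lambda>x. g (f x)) has_derivative h' x) (at x)" if x: "x \<in> S" for x
  proof -
    have fx: "f x \<in> T" using x Suc.prems by auto
    have "((g \<circ> f) has_derivative (g' (f x) \<circ> f' x)) (at x)"
      using f'(1)[OF x] g'(1)[OF fx] by (rule diff_chain_at)
    moreover have "g' (f x) w = (\<Sum>b\<in>Basis. (w \<bullet> b) *\<^sub>R g' (f x) b)" for w
    proof -
      have l: "linear (g' (f x))" using g'(1)[OF fx] has_derivative_linear by blast
      have "g' (f x) w = g' (f x) (\<Sum>b\<in>Basis. (w \<bullet> b) *\<^sub>R b)" by (simp add: euclidean_representation)
      then show ?thesis by (simp add: linear_sum[OF l] linear_scale[OF l])
    qed
    then have "g' (f x) \<circ> f' x = h' x"
      unfolding h'_def o_def by (intro ext) assumption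
    ultimately show ?thesis by (simp add: o_def)
  qed
  moreover have "Ck_on k S (\<lambda>x. h' x v)" for v
  proof -
    have f: "Ck_on k S f" using Suc.prems Ck_on_SucD by blast
    have "Ck_on k S (\<lambda>x. f' x v \<bullet> b)" for b
      by (intro Ck_on_linear_image[of "\<lambda>y. y \<bullet> b"] f'(2) bounded_linear_inner_left)
    moreover have "Ck_on k S (\<lambda>x. g' (f x) b)" for b
      using Suc.IH[OF _ f g'(2)] Suc.prems by blast
    ultimately show ?thesis unfolding h'_def by (intro Ck_on_sum Ck_on_scaleR)
  qed
  ultimately show ?case by (rule Ck_on_SucI)
qed

lemma Ck_on_vec_nth: "Ck_on k S f \<Longrightarrow> Ck_on k S (\<lambda>x. f x $ i)"
  by (rule Ck_on_linear_image[OF bounded_linear_vec_nth])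

lemma Ck_on_vec_lambda:
  fixes f :: "'a::real_normed_vector \<Rightarrow> 'n::finite \<Rightarrow> real"
  assumes "\<And>i. Ck_on k S (\<lambda>x. f x i)"
  shows "Ck_on k S (\<lambda>x. \<chi> i. f x i)"
proof -
  have "(\<lambda>x. \<chi> i. f x i) = (\<lambda>x. \<Sum>i\<in>UNIV. f x i *\<^sub>R axis i 1)"
    by (auto simp: vec_eq_iff axis_def if_distrib cong: if_cong)
  then show ?thesis by (simp only:) (intro Ck_on_sum Ck_on_scaleR assms Ck_on_const)
qed

lemma Ck_on_det:
  fixes M :: "'a::real_normed_vector \<Rightarrow> 'n::finite \<Rightarrow> 'n \<Rightarrow> real"
  assumes "\<And>i j. Ck_on k S (\<lambda>x. M x i j)"
  shows "Ck_on k S (\<lambda>x. det (\<chi> i j. M x i j))"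
  unfolding det_def by (simp, intro Ck_on_sum Ck_on_mult Ck_on_const Ck_on_prod assms)

text \<open>The inverse function theorem provides a differentiable local inverse \<open>\<Gamma>\<close> with
  \<open>\<Gamma>'(z) = \<Psi>'(\<Gamma> z)\<^sup>-\<^sup>1\<close>. By Cramer's rule the right hand side is a rational expression in the
  entries of \<open>\<Psi>'(\<Gamma> z)\<close>, so \<open>\<Gamma>'\<close> is of class \<open>C\<^sup>k\<close> whenever \<open>\<Gamma>\<close> is, and smoothness follows by
  bootstrapping.\<close>

lemma smooth_local_inverse:
  fixes \<Psi> :: "real ^ 'n::finite \<Rightarrow> real ^ 'n"
  assumes "open W" and "y0 \<in> W" and smooth: "\<And>k. Ck_on k W \<Psi>"
    and inj: "\<And>D. (\<Psi> has_derivative D) (at y0) \<Longrightarrow> inj D"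
  obtains O1 O2 \<Gamma> where "open O1" "O1 \<subseteq> W" "y0 \<in> O1" "open O2" "\<Psi> ` O1 \<subseteq> O2"
    "\<And>y. y \<in> O1 \<Longrightarrow> \<Gamma> (\<Psi> y) = y" "\<And>k. Ck_on k O2 \<Gamma>"
proof -
  obtain D where D: "\<And>y. y \<in> W \<Longrightarrow> (\<Psi> has_derivative D y) (at y)"
    and "\<And>v. continuous_on W (\<lambda>y. D y v)"
    using Ck_on_SucE[OF smooth[of "Suc 0"]] by (metis Ck_on.simps(1))
  have D_unique: "D' = D y" if "y \<in> W" "(\<Psi> has_derivative D') (at y)" for D' y
    using has_derivative_unique[OF that(2) D[OF that(1)]] .
  \<comment> \<open>\<open>Ck_on\<close> yields a derivative for each order separately; they all agree with \<open>D\<close>.\<close>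
  have smooth_D: "Ck_on k W (\<lambda>y. D y v)" for k v
  proof -
    obtain D' where D': "\<And>y. y \<in> W \<Longrightarrow> (\<Psi> has_derivative D' y) (at y)" "Ck_on k W (\<lambda>y. D' y v)"
      using Ck_on_SucE[OF smooth[of "Suc k"]] by metis
    then show ?thesis using Ck_on_cong[OF \<open>open W\<close> D'(2)] D_unique by metis
  qed
  define B where "B y = Blinfun (D y)" for y
  have B: "blinfun_apply (B y) = D y" if "y \<in> W" for y
    unfolding B_def using D[OF that] bounded_linear_Blinfun_apply has_derivative_bounded_linear by blast
  have contB: "continuous_on W B"
  proof (rule continuous_on_blinfun_componentwise)
    fix i :: "real ^ 'n"
    show "continuous_on W (\<lambda>y. blinfun_apply (B y) i)"
      using smooth_D[of 0 i] by (simp add: B cong: continuous_on_cong)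
  qed
  have lin0: "linear (D y0)" using D[OF \<open>y0 \<in> W\<close>] has_derivative_linear by blast
  obtain L where L: "linear L" "L \<circ> D y0 = id"
    using linear_injective_left_inverse[OF lin0 inj[OF D[OF \<open>y0 \<in> W\<close>]]] by auto
  have BL: "Blinfun L o\<^sub>L B y0 = id_blinfun"
    using L by (intro blinfun_eqI) (simp add: B \<open>y0 \<in> W\<close> bounded_linear_Blinfun_apply linear_conv_bounded_linear pointfree_idE)
  have derB: "\<And>y. y \<in> W \<Longrightarrow> (\<Psi> has_derivative blinfun_apply (B y)) (at y)"
    using D B by simp
  obtain O1 O2 \<Gamma> \<Gamma>' where O: "open O1" "O1 \<subseteq> W" "y0 \<in> O1" "open O2" "\<Psi> y0 \<in> O2"
    "homeomorphism O1 O2 \<Psi> \<Gamma>" and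
    \<Gamma>': "\<And>z. z \<in> O2 \<Longrightarrow> (\<Gamma> has_derivative \<Gamma>' z) (at z)"
    "\<And>z. z \<in> O2 \<Longrightarrow> \<Gamma>' z = inv (blinfun_apply (B (\<Gamma> z)))"
    "\<And>z. z \<in> O2 \<Longrightarrow> bij (blinfun_apply (B (\<Gamma> z)))"
    by (rule inverse_function_theorem[OF \<open>open W\<close> derB contB \<open>y0 \<in> W\<close> BL]) (assumption, blast intro: that)
  have \<Gamma>W: "\<Gamma> ` O2 \<subseteq> W" using O by (simp add: homeomorphism_def)
  define P where "P z = (\<chi> i j. D (\<Gamma> z) (axis j 1) $ i)" for z
  have P: "det (P z) \<noteq> 0" "\<Gamma>' z v = (\<chi> k. det (\<chi> i j. if j = k then v $ i else P z $ i $ j) / det (P z))"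
    if z: "z \<in> O2" for z v
  proof -
    have zW: "\<Gamma> z \<in> W" using \<Gamma>W z by auto
    have lin: "linear (D (\<Gamma> z))" using D[OF zW] has_derivative_linear by blast
    have PD: "P z = matrix (D (\<Gamma> z))" by (simp add: P_def matrix_def)
    have Pv: "P z *v w = D (\<Gamma> z) w" for w
      unfolding PD using lin by (simp add: matrix_works linear_matrix_vector_mul_eq)
    have bij: "bij (D (\<Gamma> z))" using \<Gamma>'(3)[OF z] B[OF zW] by simp
    show *: "det (P z) \<noteq> 0"
      using bij lin PD by (simp add: det_nz_iff_inj bij_is_inj)
    have "D (\<Gamma> z) (\<Gamma>' z v) = v"
      using \<Gamma>'(2)[OF z] B[OF zW] bij by (simp add: bij_is_surj surj_f_inv_f)
    then show "\<Gamma>' z v = (\<chi> k. det (\<chi> i j. if j = k then v $ i else P z $ i $ j) / det (P z))"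
      using cramer[OF *, of "\<Gamma>' z v" v] Pv by simp
  qed
  have "Ck_on k O2 \<Gamma>" for k
  proof (induction k)
    case 0
    then show ?case using O by (simp add: homeomorphism_def)
  next
    case (Suc k)
    have DG: "Ck_on k O2 (\<lambda>z. P z $ i $ j)" for i j
      unfolding P_def using Ck_on_compose[OF \<Gamma>W Suc Ck_on_vec_nth[OF smooth_D]] by simp
    have "Ck_on k O2 (\<lambda>z. if j = l then v $ i else P z $ i $ j)" for v i j l
      by (cases "j = l") (simp_all add: DG Ck_on_const)
    then have num: "Ck_on k O2 (\<lambda>z. det (\<chi> i j. if j = l then v $ i else P z $ i $ j))" for v l
      by (rule Ck_on_det)
    have "Ck_on k O2 (\<lambda>z. det (P z))"
      using Ck_on_det[of k O2 "\<lambda>z i j. P z $ i $ j", OF DG] by simp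
    then have den: "Ck_on k O2 (\<lambda>z. inverse (det (P z)))"
      using Ck_on_inverse P(1) by blast
    have "Ck_on k O2 (\<lambda>z. \<chi> l. det (\<chi> i j. if j = l then v $ i else P z $ i $ j) / det (P z))" for v
      unfolding divide_inverse by (intro Ck_on_vec_lambda Ck_on_mult num den)
    then have "Ck_on k O2 (\<lambda>z. \<Gamma>' z v)" for v
      by (rule Ck_on_cong[OF \<open>open O2\<close>]) (simp add: P(2))
    with \<Gamma>'(1) show ?case by (rule Ck_on_SucI)
  qed
  with O show ?thesis by (intro that[of O1 O2 \<Gamma>]) (auto simp: homeomorphism_def)
qed

section \<open>Uniqueness of derivatives on simplices and corners\<close>

text \<open>Derivatives within a set that is not open need not be unique. They agree on every direction in
  which the set contains a short segment starting at the point.\<close>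

lemma has_derivative_unique_along:
  assumes "(f has_derivative f') (at x within S)" and "(f has_derivative f'') (at x within S)"
    and "0 < e" and ray: "\<And>t. 0 < t \<Longrightarrow> t < e \<Longrightarrow> x + t *\<^sub>R u \<in> S"
  shows "f' u = f'' u"
proof -
  have *: "((\<lambda>t. f (x + t *\<^sub>R u)) has_vector_derivative D u) (at 0 within {0<..<e})"
    if D: "(f has_derivative D) (at x within S)" for D
  proof -
    have "((\<lambda>t. x + t *\<^sub>R u) has_derivative (\<lambda>t. t *\<^sub>R u)) (at 0 within {0<..<e})"
      by (auto intro!: derivative_eq_intros)
    moreover have "(f has_derivative D) (at (x + 0 *\<^sub>R u) within (\<lambda>t. x + t *\<^sub>R u) ` {0<..<e})"
      using ray by (auto intro!: has_derivative_subset[OF D])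
    ultimately have "((\<lambda>t. f (x + t *\<^sub>R u)) has_derivative (\<lambda>t. D (t *\<^sub>R u))) (at 0 within {0<..<e})"
      using diff_chain_within by (fastforce simp: o_def)
    moreover have "D (t *\<^sub>R u) = t *\<^sub>R D u" for t
      using linear_scale[OF has_derivative_linear[OF D]] .
    ultimately show ?thesis by (simp add: has_vector_derivative_def)
  qed
  have "at 0 within {0<..<e} \<noteq> bot"
    using islimpt_greaterThanLessThan1[OF \<open>0 < e\<close>] by (simp add: trivial_limit_within)
  from vector_derivative_unique_within[OF this *[OF assms(1)] *[OF assms(2)]] show ?thesis .
qed

lemma std_simplex_UNIV:
  "std_simplex (UNIV :: 'n::finite set) = {x. (\<Sum>i\<in>UNIV. x $ i) \<le> 1 \<and> (\<forall>i. 0 \<le> x $ i)}"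
proof -
  have "x $ i \<le> 1" if "(\<Sum>i\<in>UNIV. x $ i) \<le> 1" "\<forall>i. 0 \<le> x $ i" for x :: "real ^ 'n" and i
    using member_le_sum[of i UNIV "\<lambda>i. x $ i"] that by fastforce
  then show ?thesis by (auto simp: std_simplex_def coord_space_def)
qed

lemma convex_std_simplex_UNIV: "convex (std_simplex (UNIV :: 'n::finite set))"
proof -
  have "std_simplex (UNIV :: 'n set) = {x. (\<Sum>i\<in>UNIV. x $ i) \<le> 1} \<inter> (\<Inter>i. {x. 0 \<le> x $ i})"
    by (auto simp: std_simplex_UNIV)
  moreover have "convex {x :: real ^ 'n. (\<Sum>i\<in>UNIV. x $ i) \<le> 1}"
    by (auto simp: convex_def sum.distrib simp flip: sum_distrib_left intro!: convex_bound_le)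
  moreover have "convex {x :: real ^ 'n. 0 \<le> x $ i}" for i
    by (auto simp: convex_def)
  ultimately show ?thesis by (auto intro!: convex_Int convex_INT)
qed

lemma zero_in_std_simplex: "0 \<in> std_simplex UNIV"
  and axis_in_std_simplex: "axis i 1 \<in> std_simplex UNIV"
  by (auto simp: std_simplex_UNIV axis_def)

text \<open>At a vertex the coordinate directions may leave the simplex to both sides. The directions
  towards the vertices always stay inside, and their differences span the space.\<close>

lemma has_derivative_unique_std_simplex:
  fixes f :: "real ^ 'n::finite \<Rightarrow> 'b::real_normed_vector"
  assumes f': "(f has_derivative f') (at x within std_simplex UNIV)"
    and f'': "(f has_derivative f'') (at x within std_simplex UNIV)" and x: "x \<in> std_simplex UNIV"
  shows "f' = f''"
proof -
  have l: "linear f'" "linear f''" using f' f'' has_derivative_linear by blast+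
  have *: "f' (y - x) = f'' (y - x)" if "y \<in> std_simplex UNIV" for y
  proof (rule has_derivative_unique_along[OF f' f'', of 1])
    fix t :: real assume "0 < t" "t < 1"
    then have "(1 - t) *\<^sub>R x + t *\<^sub>R y \<in> std_simplex UNIV"
      using convexD[OF convex_std_simplex_UNIV x that, of "1 - t" t] by simp
    then show "x + t *\<^sub>R (y - x) \<in> std_simplex UNIV" by (simp add: algebra_simps)
  qed simp
  have "f' b = f'' b" if bB: "b \<in> Basis" for b
  proof -
    obtain i where b: "b = axis i 1" using bB by (auto simp: Basis_vec_def)
    have "f' (b - x) - f' (0 - x) = f'' (b - x) - f'' (0 - x)"
      using *[OF axis_in_std_simplex, of i] *[OF zero_in_std_simplex] b by (simp only:)
    then show ?thesis by (simp add: linear_diff[OF l(1)] linear_diff[OF l(2)] linear_0[OF l(1)] linear_0[OF l(2)] linear_neg[OF l(1)] linear_neg[OF l(2)])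
  qed
  then show ?thesis using linear_eq_stdbasis l by blast
qed

lemma has_derivative_unique_corner:
  fixes f :: "real ^ 'n::finite \<Rightarrow> 'b::real_normed_vector"
  assumes f': "(f has_derivative f') (at x within Y)" and f'': "(f has_derivative f'') (at x within Y)"
    and Y: "openin (top_of_set (corner_model s)) Y" and x: "x \<in> Y"
  shows "f' = f''"
proof -
  have l: "linear f'" "linear f''" using f' f'' has_derivative_linear by blast+
  obtain e where e: "e > 0" "ball x e \<inter> corner_model s \<subseteq> Y"
    using Y x by (metis openin_contains_ball)
  have "f' b = f'' b" if bB: "b \<in> Basis" for b
  proof -
    obtain i where b: "b = axis i 1" using bB by (auto simp: Basis_vec_def)
    \<comment> \<open>The axis direction is reversed if the corner lies on its negative side, so that it points inwards.\<close>
    define r :: real where "r = (if 0 \<le> s $ i then 1 else - 1)"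
    have r: "r \<noteq> 0" "\<bar>r\<bar> = 1" "0 \<le> s $ i * r" by (auto simp: r_def)
    have "f' (r *\<^sub>R b) = f'' (r *\<^sub>R b)"
    proof (rule has_derivative_unique_along[OF f' f'' \<open>e > 0\<close>])
      fix t :: real assume t: "0 < t" "t < e"
      have "x \<in> corner_model s" using Y x openin_imp_subset by blast
      then have "0 \<le> s $ j * (x + t *\<^sub>R r *\<^sub>R b) $ j" for j
        using r t b by (cases "j = i") (auto simp: corner_model_def axis_def distrib_left mult.left_commute[of _ t])
      moreover have "x + t *\<^sub>R r *\<^sub>R b \<in> ball x e"
        using t r bB by (simp add: dist_norm abs_mult)
      ultimately show "x + t *\<^sub>R r *\<^sub>R b \<in> Y" using e by (auto simp: corner_model_def)
    qed
    then show ?thesis using r(1) by (simp add: linear_scale[OF l(1)] linear_scale[OF l(2)])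
  qed
  then show ?thesis using linear_eq_stdbasis l by blast
qed

text \<open>Maps into a manifold are differentiated on the relatively open set of points mapped into a chart
  domain; this lets derivatives be transferred to the whole simplex.\<close>

lemma at_within_openin:
  assumes "openin (top_of_set S) T" and "x \<in> T"
  shows "at x within T = at x within S"
proof -
  obtain W where "open W" "T = S \<inter> W" using assms by (auto simp: openin_open)
  then show ?thesis using assms at_within_nhd[of x W T S] by auto
qed

section \<open>Linear functionals and forms\<close>

text \<open>A left inverse of the injective linear map \<open>v \<mapsto> (l\<^sub>j v)\<^sub>j\<close>. It is obtained by inverting the
  Gram operator \<open>v \<mapsto> \<Sum>\<^sub>j (a\<^sub>j \<bullet> v) a\<^sub>j\<close> of the vectors \<open>a\<^sub>j\<close> representing \<open>l\<^sub>j\<close>, which is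
  injective because \<open>v\<close> paired with its image is \<open>\<Sum>\<^sub>j (l\<^sub>j v)\<^sup>2\<close>. The number of functionals is a
  plain natural number, so the target space needs no type of its own.\<close>

lemma linear_functionals_dual_frame:
  fixes l :: "nat \<Rightarrow> 'a::euclidean_space \<Rightarrow> real"
  assumes lin: "\<And>j. j < k \<Longrightarrow> linear (l j)" and inj: "\<And>v. (\<And>j. j < k \<Longrightarrow> l j v = 0) \<Longrightarrow> v = 0"
  obtains m where "\<And>v. v = (\<Sum>j<k. l j v *\<^sub>R m j)"
proof -
  define a where "a j = (\<Sum>b\<in>Basis. l j b *\<^sub>R b)" for j
  have la: "l j v = a j \<bullet> v" if "j < k" for j v
  proof -
    have "l j v = l j (\<Sum>b\<in>Basis. (v \<bullet> b) *\<^sub>R b)" by (simp add: euclidean_representation)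
    also have "\<dots> = (\<Sum>b\<in>Basis. (v \<bullet> b) * l j b)"
      by (simp add: linear_sum[OF lin[OF that]] linear_scale[OF lin[OF that]])
    also have "\<dots> = a j \<bullet> v"
      by (simp add: a_def inner_sum_left inner_commute[of v] mult.commute)
    finally show ?thesis .
  qed
  define Gr where "Gr v = (\<Sum>j<k. (a j \<bullet> v) *\<^sub>R a j)" for v
  have linG: "linear Gr"
    unfolding Gr_def
    by (intro linearI) (simp_all add: inner_add_right scaleR_add_left sum.distrib scaleR_sum_right)
  have "v = 0" if "Gr v = 0" for v
  proof (rule inj)
    have "Gr v \<bullet> v = (\<Sum>j<k. (a j \<bullet> v)\<^sup>2)"
      by (simp add: Gr_def inner_sum_left power2_eq_square)
    then have "(\<Sum>j<k. (a j \<bullet> v)\<^sup>2) = 0" using that by simp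
    then show "l j v = 0" if "j < k" for j
      using that by (simp add: la sum_nonneg_eq_0_iff)
  qed
  then have "inj Gr" using linear_injective_0[OF linG] by blast
  then obtain L where L: "linear L" "L \<circ> Gr = id"
    using linear_injective_left_inverse[OF linG] by auto
  have "v = (\<Sum>j<k. l j v *\<^sub>R L (a j))" for v
  proof -
    have "v = L (Gr v)" using L(2) by (simp add: pointfree_idE)
    also have "\<dots> = (\<Sum>j<k. l j v *\<^sub>R L (a j))"
      by (simp add: Gr_def linear_sum[OF L(1)] linear_scale[OF L(1)] la)
    finally show ?thesis .
  qed
  then show ?thesis by (rule that)
qed

lemma bilinear_form_expand:
  fixes b :: "'a::euclidean_space \<Rightarrow> 'a \<Rightarrow> real"
  assumes l: "\<And>v. linear (\<lambda>u. b u v)" and r: "\<And>u. linear (b u)"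
  shows "b v v = (\<Sum>i\<in>Basis. \<Sum>j\<in>Basis. (v \<bullet> i) * (v \<bullet> j) * b i j)"
proof -
  have "b v v = b (\<Sum>i\<in>Basis. (v \<bullet> i) *\<^sub>R i) v" by (simp add: euclidean_representation)
  also have "\<dots> = (\<Sum>i\<in>Basis. (v \<bullet> i) * b i v)"
    by (simp add: linear_sum[OF l] linear_scale[OF l])
  also have "\<dots> = (\<Sum>i\<in>Basis. (v \<bullet> i) * b i (\<Sum>j\<in>Basis. (v \<bullet> j) *\<^sub>R j))"
    by (simp add: euclidean_representation)
  also have "\<dots> = (\<Sum>i\<in>Basis. (v \<bullet> i) * (\<Sum>j\<in>Basis. (v \<bullet> j) * b i j))"
    by (simp only: linear_sum[OF r] linear_scale[OF r] real_scaleR_def)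
  finally show ?thesis by (simp add: sum_distrib_left mult.assoc)
qed

lemma inner_product_on_linear:
  assumes "inner_product_on UNIV b"
  shows "linear (\<lambda>u. b u v)" and "linear (b u)"
proof -
  have 1: "b (s *\<^sub>R x + t *\<^sub>R y) w = s * b x w + t * b y w" for s t x y w
    using assms unfolding inner_product_on_def by blast
  have 2: "b x y = b y x" for x y using assms unfolding inner_product_on_def by blast
  have *: "linear (\<lambda>u. b u v)" for v
    by (rule linearI) (use 1[of 1 _ 1] 1[of _ _ 0] in auto)
  then show "linear (\<lambda>u. b u v)" .
  have "b u = (\<lambda>x. b x u)" using 2 by blast
  then show "linear (b u)" using * by simp
qed

text \<open>At \<open>y0\<close> the form is bounded above and below on the unit sphere by compactness, and its entries
  move little near \<open>y0\<close>. Applied to a Riemannian metric and to the pullback of the Euclidean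
  metric under an immersion, this shows both equivalent to the norm of the coordinates.\<close>

lemma forms_comparable_near:
  fixes B :: "'y::metric_space \<Rightarrow> 'a::euclidean_space \<Rightarrow> 'a \<Rightarrow> real"
  assumes expand: "\<And>y v. y \<in> Y \<Longrightarrow> B y v v = (\<Sum>a\<in>Basis. \<Sum>b\<in>Basis. (v \<bullet> a) * (v \<bullet> b) * B y a b)"
    and cont: "\<And>a b. continuous_on Y (\<lambda>y. B y a b)"
    and pos: "\<And>v. v \<noteq> 0 \<Longrightarrow> 0 < B y0 v v" and y0: "y0 \<in> Y"
  obtains m M e where "0 < m" "0 < M" "0 < e"
    "\<And>y v. y \<in> Y \<Longrightarrow> dist y y0 < e \<Longrightarrow> m * (norm v)\<^sup>2 \<le> B y v v \<and> B y v v \<le> M * (norm v)\<^sup>2"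
proof -
  define q where "q v = (\<Sum>a\<in>Basis. \<Sum>b\<in>Basis. (v \<bullet> a) * (v \<bullet> b) * B y0 a b)" for v
  have q: "B y0 v v = q v" for v using expand[OF y0] by (simp add: q_def)
  have "continuous_on (sphere 0 1) q"
    unfolding q_def by (intro continuous_intros)
  moreover have "compact (sphere (0::'a) 1)" "sphere (0::'a) 1 \<noteq> {}" by auto
  ultimately obtain u w where u: "u \<in> sphere 0 1" "\<And>v. v \<in> sphere 0 1 \<Longrightarrow> q u \<le> q v"
    and w: "w \<in> sphere 0 1" "\<And>v. v \<in> sphere 0 1 \<Longrightarrow> q v \<le> q w"
    using continuous_attains_inf[of "sphere 0 1" q] continuous_attains_sup[of "sphere 0 1" q] by blast
  have qu: "0 < q u" using pos[of u] q u by fastforce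
  have qw: "0 < q w" using u(2)[OF w(1)] qu by simp
  have qscale: "q (c *\<^sub>R v) = c\<^sup>2 * q v" for c v
    by (simp add: q_def sum_distrib_left power2_eq_square mult_ac)
  have qb: "q u * (norm v)\<^sup>2 \<le> q v \<and> q v \<le> q w * (norm v)\<^sup>2" for v
  proof (cases "v = 0")
    case True
    then show ?thesis by (simp add: q_def)
  next
    case False
    define v' where "v' = (1 / norm v) *\<^sub>R v"
    have v': "v' \<in> sphere 0 1" "v = norm v *\<^sub>R v'" using False by (simp_all add: v'_def)
    have "q v = (norm v)\<^sup>2 * q v'" using qscale[of "norm v" v'] v'(2) by simp
    then show ?thesis
      using mult_left_mono[OF u(2)[OF v'(1)], of "(norm v)\<^sup>2"] mult_left_mono[OF w(2)[OF v'(1)], of "(norm v)\<^sup>2"]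
      by (simp add: mult.commute)
  qed
  \<comment> \<open>The sum of the entrywise deviations bounds the deviation of the form on unit vectors.\<close>
  define E where "E y = (\<Sum>a\<in>Basis. \<Sum>b\<in>Basis. \<bar>B y a b - B y0 a b\<bar>)" for y
  have "continuous_on Y E" unfolding E_def by (intro continuous_intros cont)
  moreover have "E y0 = 0" by (simp add: E_def)
  moreover have E0: "0 \<le> E y" for y unfolding E_def by (intro sum_nonneg) simp
  ultimately obtain e where e: "e > 0" "\<And>y. y \<in> Y \<Longrightarrow> dist y y0 < e \<Longrightarrow> E y < q u / 2"
    using y0 qu unfolding continuous_on_iff by (smt (verit, best) dist_real_def half_gt_zero)
  have diff: "\<bar>B y v v - q v\<bar> \<le> E y * (norm v)\<^sup>2" if "y \<in> Y" for y v
  proof -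
    have "\<bar>B y v v - q v\<bar> = \<bar>\<Sum>a\<in>Basis. \<Sum>b\<in>Basis. (v \<bullet> a) * (v \<bullet> b) * (B y a b - B y0 a b)\<bar>"
      by (simp add: expand[OF that] q_def sum_subtractf right_diff_distrib)
    also have "\<dots> \<le> (\<Sum>a\<in>Basis. \<Sum>b\<in>Basis. \<bar>(v \<bullet> a) * (v \<bullet> b) * (B y a b - B y0 a b)\<bar>)"
      by (intro order_trans[OF sum_abs] sum_mono sum_abs)
    also have "\<dots> \<le> (\<Sum>a\<in>Basis. \<Sum>b\<in>Basis. (norm v * norm v) * \<bar>B y a b - B y0 a b\<bar>)"
      by (intro sum_mono) (auto simp: abs_mult intro!: mult_mono Basis_le_norm)
    also have "\<dots> = E y * (norm v)\<^sup>2"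
      by (simp add: E_def sum_distrib_left power2_eq_square mult.commute)
    finally show ?thesis .
  qed
  have "q u / 2 * (norm v)\<^sup>2 \<le> B y v v \<and> B y v v \<le> (q w + q u / 2) * (norm v)\<^sup>2"
    if "y \<in> Y" "dist y y0 < e" for y v
  proof -
    have "E y * (norm v)\<^sup>2 \<le> q u / 2 * (norm v)\<^sup>2"
      using e(2)[OF that] by (intro mult_right_mono) auto
    with diff[OF that(1), of v] qb[of v] show ?thesis
      unfolding distrib_right abs_le_iff by (intro conjI) linarith+
  qed
  then show ?thesis using qu qw e(1) by (intro that[of "q u / 2" "q w + q u / 2" e]) auto
qed

section \<open>An orientation reversing involution of the standard simplex\<close>

definition flip_linear :: "'n \<Rightarrow> real ^ 'n::finite \<Rightarrow> real ^ 'n" where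
  "flip_linear i v = (\<chi> j. if j = i then - (\<Sum>l\<in>UNIV. v $ l) else v $ j)"

text \<open>The affine map exchanging the vertices \<open>0\<close> and \<open>axis i 1\<close> and fixing the others.\<close>

definition simplex_flip :: "'n \<Rightarrow> real ^ 'n::finite \<Rightarrow> real ^ 'n" where
  "simplex_flip i x = flip_linear i x + axis i 1"

lemma sum_flip_linear: "(\<Sum>l\<in>UNIV. flip_linear i v $ l) = - v $ i"
proof -
  have "(\<Sum>l\<in>UNIV. flip_linear i v $ l) = flip_linear i v $ i + (\<Sum>l\<in>UNIV - {i}. flip_linear i v $ l)"
    by (simp add: sum.remove)
  also have "(\<Sum>l\<in>UNIV - {i}. flip_linear i v $ l) = (\<Sum>l\<in>UNIV - {i}. v $ l)"
    by (intro sum.cong) (auto simp: flip_linear_def)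
  also have "\<dots> = (\<Sum>l\<in>UNIV. v $ l) - v $ i" by (simp add: sum_diff1)
  finally show ?thesis by (simp add: flip_linear_def)
qed

lemma linear_flip: "linear (flip_linear i)"
  by (intro linearI) (auto simp: flip_linear_def vec_eq_iff sum.distrib sum_distrib_left)

lemma flip_linear_involution: "flip_linear i (flip_linear i v) = v"
proof -
  have "flip_linear i (flip_linear i v) $ j = v $ j" for j
    using sum_flip_linear[of i v] by (simp add: flip_linear_def[of i "flip_linear i v"]) (simp add: flip_linear_def)
  then show ?thesis by (simp add: vec_eq_iff)
qed

lemma simplex_flip_involution: "simplex_flip i (simplex_flip i x) = x"
proof -
  have "flip_linear i (axis i 1) = - axis i 1"
    by (auto simp: flip_linear_def vec_eq_iff axis_def)
  then show ?thesis
    by (simp add: simplex_flip_def linear_add[OF linear_flip] flip_linear_involution)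
qed

lemma simplex_flip_std_simplex: "simplex_flip i ` std_simplex UNIV = std_simplex UNIV"
proof -
  have "simplex_flip i x \<in> std_simplex UNIV" if "x \<in> std_simplex UNIV" for x :: "real ^ 'a"
  proof -
    have "(\<Sum>l\<in>UNIV. simplex_flip i x $ l) = 1 - x $ i"
      by (simp add: simplex_flip_def sum.distrib sum_flip_linear axis_def)
    with that show ?thesis
      by (auto simp: std_simplex_UNIV simplex_flip_def flip_linear_def axis_def)
  qed
  then show ?thesis by (metis simplex_flip_involution image_eqI subsetI subset_antisym image_subsetI)
qed

text \<open>The matrix differs from the identity in row \<open>i\<close> only, whose entries are all \<open>-1\<close>. Adding the
  other rows to it leaves the diagonal matrix with entry \<open>-1\<close> in place \<open>i\<close>.\<close>

lemma det_flip_linear: "det (matrix (flip_linear i)) = - 1"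
proof -
  define Dg :: "real ^ 'a ^ 'a" where "Dg = (\<chi> k l. if k = l then (if k = i then - 1 else 1) else 0)"
  define w :: "real ^ 'a" where "w = (\<Sum>j\<in>UNIV - {i}. - row j Dg)"
  have row: "row j Dg = axis j 1" if "j \<noteq> i" for j
    using that by (auto simp: row_def Dg_def axis_def vec_eq_iff)
  have "w \<in> vec.span {row j Dg |j. j \<noteq> i}"
    unfolding w_def by (intro vec.span_sum vec.span_neg vec.span_base) auto
  then have "det (\<chi> k. if k = i then row i Dg + w else row k Dg) = det Dg"
    by (rule det_row_span)
  moreover have "w $ l = (if l = i then 0 else - 1)" for l
    by (simp add: w_def row axis_def sum_negf sum.delta')
  then have "(\<chi> k. if k = i then row i Dg + w else row k Dg) = matrix (flip_linear i)"
    by (auto simp: vec_eq_iff matrix_def flip_linear_def row_def Dg_def axis_def)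
  moreover have "det Dg = (\<Prod>k\<in>UNIV. if k = i then - 1 else 1)"
    by (subst det_diagonal) (auto simp: Dg_def)
  ultimately show ?thesis by simp
qed

lemma simplex_flip_has_derivative: "(simplex_flip i has_derivative flip_linear i) F"
proof -
  have "(flip_linear i has_derivative flip_linear i) F"
    using linear_flip[of i] by (simp add: linear_conv_bounded_linear bounded_linear_imp_has_derivative)
  then show ?thesis
    unfolding simplex_flip_def[abs_def] by (auto intro!: derivative_eq_intros)
qed

section \<open>Affine maps into Euclidean space\<close>

lemma affine_into_functionals:
  assumes "affine_into k F"
  shows "linear (\<lambda>v. F v j - F 0 j)"
    and "inj F \<Longrightarrow> (\<And>j. j < k \<Longrightarrow> F v j - F 0 j = 0) \<Longrightarrow> v = 0"
proof -
  show "linear (\<lambda>v. F v j - F 0 j)" using assms by (simp add: affine_into_def)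
  have zero: "F w i = 0" if "k \<le> i" for w i
    using assms that by (auto simp: affine_into_def topspace_Euclidean_space)
  assume "inj F" and *: "\<And>j. j < k \<Longrightarrow> F v j - F 0 j = 0"
  have "F v i = F 0 i" for i using *[of i] zero[of i] by (cases "i < k") auto
  then show "v = 0" using \<open>inj F\<close> by (auto dest: injD)
qed

lemma affine_into_has_derivative:
  fixes F :: "real ^ 'n::finite \<Rightarrow> nat \<Rightarrow> real"
  assumes "affine_into k F"
  shows "((\<lambda>x. F x j) has_derivative (\<lambda>v. F v j - F 0 j)) net"
proof -
  have "((\<lambda>x. F x j - F 0 j) has_derivative (\<lambda>v. F v j - F 0 j)) net"
    using affine_into_functionals(1)[OF assms] by (simp add: linear_conv_bounded_linear bounded_linear_imp_has_derivative)
  from has_derivative_add[OF this has_derivative_const[of "F 0 j"]] show ?thesis by simp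
qed

lemma affine_into_smooth:
  fixes F :: "real ^ 'n::finite \<Rightarrow> nat \<Rightarrow> real"
  assumes "affine_into k F"
  shows "Ck_on r S (\<lambda>x. F x j)"
proof -
  have "bounded_linear (\<lambda>v. F v j - F 0 j)"
    using affine_into_functionals(1)[OF assms] by (simp add: linear_conv_bounded_linear)
  from Ck_on_add[OF Ck_on_bounded_linear[OF this] Ck_on_const[of _ _ "F 0 j"]] show ?thesis by simp
qed

text \<open>The quotient of supremum and infimum bounds the distortion only if the infimum is positive and
  the supremum is taken over a bounded set: division by zero and suprema of unbounded sets have
  arbitrary values. A left inverse of the linear part of \<open>F\<close> bounds the stretch from below, and
  boundedness of its components bounds it from above.\<close>

lemma affine_stretch_bounds:
  fixes F :: "'v::euclidean_space \<Rightarrow> nat \<Rightarrow> real"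
  assumes aff: "affine_into k F" and "inj F"
    and K: "(SUP v\<in>- {0}. linear_stretch k F v) / (INF w\<in>- {0}. linear_stretch k F w) \<le> K"
  obtains a b where "0 < a" "0 < b" "b \<le> K * a"
    "\<And>v. a * norm v \<le> L2_set (\<lambda>j. F v j - F 0 j) {..<k}"
    "\<And>v. L2_set (\<lambda>j. F v j - F 0 j) {..<k} \<le> b * norm v"
proof -
  let ?l = "\<lambda>j v. F v j - F 0 j" and ?N = "\<lambda>v. L2_set (\<lambda>j. F v j - F 0 j) {..<k}"
  have lin: "linear (?l j)" for j by (rule affine_into_functionals(1)[OF aff])
  obtain m where m: "\<And>v. v = (\<Sum>j<k. ?l j v *\<^sub>R m j)"
    by (rule linear_functionals_dual_frame[of k ?l, OF lin affine_into_functionals(2)[OF aff \<open>inj F\<close>]]) blast+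
  define C where "C = L2_set (\<lambda>j. norm (m j)) {..<k} + 1"
  have C: "0 < C" by (simp add: C_def add_nonneg_pos)
  have low: "norm v \<le> C * ?N v" for v
  proof -
    have "norm v \<le> (\<Sum>j<k. norm (?l j v *\<^sub>R m j))"
      using m[of v] norm_sum by metis
    also have "\<dots> = (\<Sum>j<k. \<bar>?l j v\<bar> * \<bar>norm (m j)\<bar>)" by simp
    also have "\<dots> \<le> ?N v * L2_set (\<lambda>j. norm (m j)) {..<k}" by (rule L2_set_mult_ineq)
    also have "\<dots> \<le> C * ?N v" by (simp add: C_def algebra_simps)
    finally show ?thesis .
  qed
  have "\<exists>B. \<forall>v. \<bar>?l j v\<bar> \<le> B * norm v" for j
    using linear_bounded[OF lin] by auto
  then obtain B where B: "\<And>j v. \<bar>?l j v\<bar> \<le> B j * norm v" by metis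
  have up: "?N v \<le> (\<Sum>j<k. B j) * norm v" for v
    using order_trans[OF L2_set_le_sum_abs sum_mono[OF B]] by (simp add: sum_distrib_right)
  let ?st = "linear_stretch k F"
  define a b where "a = (INF w\<in>- {0}. ?st w)" and "b = (SUP v\<in>- {0}. ?st v)"
  have st: "1 / C \<le> ?st v" "?st v \<le> (\<Sum>j<k. B j)" if "v \<noteq> 0" for v
    using low[of v] up[of v] C that by (simp_all add: linear_stretch_def field_simps)
  have ne: "- {0::'v} \<noteq> {}" using nonempty_Basis nonzero_Basis by fastforce
  have "1 / C \<le> a" unfolding a_def using st(1) ne by (intro cINF_greatest) auto
  then have a: "0 < a" using C by (smt (verit) divide_pos_pos)
  have av: "a \<le> ?st v" "?st v \<le> b" if "v \<noteq> 0" for v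
    unfolding a_def b_def using that st
    by (auto intro!: cINF_lower cSUP_upper bdd_belowI2[of _ "1 / C"] bdd_aboveI2[of _ _ "\<Sum>j<k. B j"])
  obtain v0 :: 'v where "v0 \<noteq> 0" using ne by auto
  then have b: "0 < b" using av[of v0] a by simp
  have N: "?N v = ?st v * norm v" for v
    using up[of v] L2_set_nonneg[of "\<lambda>j. ?l j v" "{..<k}"] by (cases "v = 0") (auto simp: linear_stretch_def L2_set_def)
  show ?thesis
  proof (rule that[OF a b])
    show "b \<le> K * a" using K a by (simp add: a_def b_def divide_le_eq)
    show "a * norm v \<le> ?N v" "?N v \<le> b * norm v" for v
      unfolding N using av[of v] by (cases "v = 0"; simp add: mult_right_mono)+
  qed
qed

section \<open>Charts and tangent maps\<close>

lemma smooth_onE: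
  assumes "smooth_on S f" and "x \<in> S"
  obtains W F where "open W" "x \<in> W" "\<And>k. Ck_on k W F" "\<And>y. y \<in> S \<Longrightarrow> y \<in> W \<Longrightarrow> F y = f y"
  using assms unfolding smooth_on_def by (metis IntI)

lemma smooth_extension_derivative:
  assumes "open W" and "\<And>k. Ck_on k W F"
  obtains D where "\<And>y. y \<in> W \<Longrightarrow> (F has_derivative D y) (at y)" "\<And>v. continuous_on W (\<lambda>y. D y v)"
  using Ck_on_SucE[OF assms(2)[of "Suc 0"]] by (metis Ck_on.simps(1))

lemma has_derivative_within_extension:
  assumes D: "(F has_derivative D) (at x)" and "open W" and "x \<in> W" and "x \<in> S"
    and eq: "\<And>y. y \<in> S \<Longrightarrow> y \<in> W \<Longrightarrow> F y = f y"
  shows "(f has_derivative D) (at x within S)"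
proof -
  have "(f has_derivative D) (at x within (S \<inter> W))"
    using has_derivative_transform[of x "S \<inter> W" f F D] has_derivative_at_withinI[OF D, of "S \<inter> W"] assms
    by auto
  moreover have "at x within (S \<inter> W) = at x within S"
    using assms by (intro at_within_openin) (auto simp: openin_open)
  ultimately show ?thesis by simp
qed

lemma smooth_on_has_derivative:
  assumes "smooth_on S f" and "x \<in> S"
  shows "(f has_derivative frechet_derivative f (at x within S)) (at x within S)"
proof -
  obtain W F where F: "open W" "x \<in> W" "\<And>k. Ck_on k W F" "\<And>y. y \<in> S \<Longrightarrow> y \<in> W \<Longrightarrow> F y = f y"
    using smooth_onE[OF assms] by blast
  obtain D where "(F has_derivative D) (at x)"
    using smooth_extension_derivative[OF F(1,3)] F(2) by metis
  then have "f differentiable at x within S"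
    using has_derivative_within_extension[OF _ F(1,2) assms(2) F(4)] by (intro differentiableI)
  then show ?thesis by (simp add: frechet_derivative_works)
qed

lemma smooth_on_continuous:
  assumes "smooth_on S f" shows "continuous_on S f"
  using smooth_on_has_derivative[OF assms] has_derivative_continuous continuous_on_eq_continuous_within by blast

locale atlas_manifold =
  fixes X :: "'a topology" and A :: "('a, 'n::finite) chart set"
  assumes manifold: "oriented_manifold X A"
begin

lemma chart_obtain:
  assumes "c \<in> A" obtains s where "is_chart X s c"
  using assms manifold unfolding oriented_manifold_def by blast

lemma chart_at:
  assumes "p \<in> topspace X" obtains c where "c \<in> A" "p \<in> cdom c"
  using assms manifold unfolding oriented_manifold_def by blast

lemma chart_homeo:
  assumes "c \<in> A" shows "homeomorphic_map (subtopology X (cdom c)) (top_of_set (cimg c)) (cmap c)"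
  using chart_obtain[OF assms] by (metis is_chart_def)

lemma cdom_open: "c \<in> A \<Longrightarrow> openin X (cdom c)"
  using chart_obtain by (metis is_chart_def)

lemma chart_topspace: "c \<in> A \<Longrightarrow> topspace (subtopology X (cdom c)) = cdom c"
  using openin_subset[OF cdom_open[of c]] by (auto simp: topspace_subtopology)

lemma chart_inj: "c \<in> A \<Longrightarrow> inj_on (cmap c) (cdom c)"
  using chart_homeo[of c] chart_topspace[of c] by (simp add: homeomorphic_eq_everything_map)

lemma cinv_cmap: "c \<in> A \<Longrightarrow> p \<in> cdom c \<Longrightarrow> cinv c (cmap c p) = p"
  using chart_inj by (rule inv_into_f_f)

lemma chart_image_open:
  assumes c: "c \<in> A" and O: "openin X O'" "O' \<subseteq> cdom c"
  shows "openin (top_of_set (cimg c)) (cmap c ` O')"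
proof -
  have "openin (subtopology X (cdom c)) O'"
    using O by (simp add: openin_open_subtopology[OF cdom_open[OF c]])
  then show ?thesis using homeomorphic_imp_open_map[OF chart_homeo[OF c]] by (simp add: open_map_def)
qed

lemma chart_image_open_corner:
  assumes c: "is_chart X s c" "c \<in> A" and O: "openin X O'" "O' \<subseteq> cdom c"
  shows "openin (top_of_set (corner_model s)) (cmap c ` O')"
  using chart_image_open[OF c(2) O] c(1) openin_trans unfolding is_chart_def by blast

lemma chart_preimage_open:
  assumes c: "c \<in> A" and W: "open W"
  shows "openin X {p \<in> cdom c. cmap c p \<in> W}"
proof -
  have "continuous_map (subtopology X (cdom c)) (top_of_set (cimg c)) (cmap c)"
    using chart_homeo[OF c] by (simp add: homeomorphic_eq_everything_map)
  then have "continuous_map (subtopology X (cdom c)) euclidean (cmap c)"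
    by (simp add: continuous_map_in_subtopology)
  then have "openin (subtopology X (cdom c)) {p \<in> topspace (subtopology X (cdom c)). cmap c p \<in> W}"
    using W by (intro openin_continuous_map_preimage) auto
  then show ?thesis unfolding chart_topspace[OF c] using openin_open_subtopology[OF cdom_open[OF c]] by blast
qed

lemma chart_change_has_derivative:
  assumes c: "c \<in> A" "c' \<in> A" and p: "p \<in> cdom c" "p \<in> cdom c'"
  shows "((cmap c' \<circ> cinv c) has_derivative chart_change c c' p) (at (cmap c p) within cimg c)"
proof -
  let ?S = "cmap c ` (cdom c \<inter> cdom c')"
  have "smooth_on ?S (cmap c' \<circ> cinv c)" using manifold c unfolding oriented_manifold_def by blast
  moreover have "cmap c p \<in> ?S" using p by auto
  moreover have "at (cmap c p) within ?S = at (cmap c p) within cimg c"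
    using chart_image_open[OF c(1) openin_Int[OF cdom_open[OF c(1)] cdom_open[OF c(2)]]] p
    by (intro at_within_openin) auto
  ultimately show ?thesis
    using smooth_on_has_derivative[of ?S "cmap c' \<circ> cinv c" "cmap c p"] unfolding chart_change_def by simp
qed

lemma chart_change_det_pos:
  assumes "c \<in> A" "c' \<in> A" "p \<in> cdom c" "p \<in> cdom c'"
  shows "0 < det (matrix (chart_change c c' p))"
  using manifold assms unfolding oriented_manifold_def by blast

abbreviation std :: "(real ^ 'n) set" where "std \<equiv> std_simplex UNIV"

lemma smooth_into_domain_open:
  assumes "smooth_into X A std f" and "openin X O'"
  shows "openin (top_of_set std) {x \<in> std. f x \<in> O'}"
  using assms openin_continuous_map_preimage[of "top_of_set std" X f O'] unfolding smooth_into_def by simp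

lemma at_within_chart_domain:
  assumes "smooth_into X A std f" and "c \<in> A" and "x \<in> std" and "f x \<in> cdom c"
  shows "at x within {x \<in> std. f x \<in> cdom c} = at x within std"
  using smooth_into_domain_open[OF assms(1) cdom_open[OF assms(2)]] assms(3,4)
  by (intro at_within_openin) auto

lemma tangent_map_has_derivative:
  assumes "smooth_into X A std f" and "c \<in> A" and "x \<in> std" and "f x \<in> cdom c"
  shows "((cmap c \<circ> f) has_derivative tangent_map c std f x) (at x within std)"
proof -
  have "smooth_on {x \<in> std. f x \<in> cdom c} (cmap c \<circ> f)" using assms unfolding smooth_into_def by blast
  from smooth_on_has_derivative[OF this, of x] show ?thesis
    using assms unfolding tangent_map_def at_within_chart_domain[OF assms] by simp
qed

text \<open>The chain rule for \<open>\<psi>\<close> in the coordinates of \<open>c\<close> after \<open>f\<close>. The derivative of \<open>\<psi>\<close> is only taken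
  within the coordinate image of a set \<open>Q\<close> that contains the image of \<open>f\<close>, because the functions it
  is used for, such as transition maps, embeddings and the inverse of \<open>f\<close>, are given on such sets
  only.\<close>

lemma chain_through_chart:
  fixes \<psi> :: "real ^ 'n \<Rightarrow> 'z::real_normed_vector"
  assumes f: "smooth_into X A std f" and c: "c \<in> A" and x: "x \<in> std" "f x \<in> cdom c"
    and img: "\<And>y. y \<in> std \<Longrightarrow> f y \<in> cdom c \<Longrightarrow> f y \<in> Q"
    and \<psi>: "(\<psi> has_derivative D) (at (cmap c (f x)) within cmap c ` (Q \<inter> cdom c))"
    and H: "\<And>y. y \<in> std \<Longrightarrow> f y \<in> cdom c \<Longrightarrow> \<psi> (cmap c (f y)) = H y"
  shows "(H has_derivative (D \<circ> tangent_map c std f x)) (at x within std)"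
proof -
  let ?S = "{x \<in> std. f x \<in> cdom c}"
  have 1: "((cmap c \<circ> f) has_derivative tangent_map c std f x) (at x within ?S)"
    using tangent_map_has_derivative[OF f c x] at_within_chart_domain[OF f c x] by simp
  have "(\<psi> has_derivative D) (at ((cmap c \<circ> f) x) within (cmap c \<circ> f) ` ?S)"
    using \<psi> img by (auto intro!: has_derivative_subset[OF \<psi>])
  from diff_chain_within[OF 1 this]
  have "((\<psi> \<circ> (cmap c \<circ> f)) has_derivative (D \<circ> tangent_map c std f x)) (at x within ?S)" .
  then have "(H has_derivative (D \<circ> tangent_map c std f x)) (at x within ?S)"
    by (rule has_derivative_transform[rotated 2]) (use H x in auto)
  then show ?thesis using at_within_chart_domain[OF f c x] by simp
qed

lemma tangent_map_chart_change:
  assumes f: "smooth_into X A std f" and c: "c \<in> A" "c' \<in> A" and x: "x \<in> std" "f x \<in> cdom c" "f x \<in> cdom c'"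
  shows "tangent_map c' std f x = chart_change c c' (f x) \<circ> tangent_map c std f x"
proof (rule has_derivative_unique_std_simplex[OF tangent_map_has_derivative[OF f c(2) x(1,3)] _ x(1)])
  show "((cmap c' \<circ> f) has_derivative chart_change c c' (f x) \<circ> tangent_map c std f x) (at x within std)"
    using chart_change_has_derivative[OF c x(2,3)]
    by (intro chain_through_chart[OF f c(1) x(1,2), of UNIV "cmap c' \<circ> cinv c"]) (auto simp: cinv_cmap[OF c(1)])
qed

lemma tangent_map_linear:
  assumes "smooth_into X A std f" and "c \<in> A" and "x \<in> std" and "f x \<in> cdom c"
  shows "linear (tangent_map c std f x)"
  using tangent_map_has_derivative[OF assms] has_derivative_linear by blast

lemma tangent_map_det_chart_change:
  assumes f: "smooth_into X A std f" and c: "c \<in> A" "c' \<in> A" and x: "x \<in> std" "f x \<in> cdom c" "f x \<in> cdom c'"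
    and pos: "0 < det (matrix (tangent_map c std f x))"
  shows "0 < det (matrix (tangent_map c' std f x))"
proof -
  have "linear (chart_change c c' (f x))"
    using chart_change_has_derivative[OF c x(2,3)] has_derivative_linear by blast
  then show ?thesis
    unfolding tangent_map_chart_change[OF f c x] using tangent_map_linear[OF f c(1) x(1,2)] pos
      chart_change_det_pos[OF c x(2,3)] by (simp add: matrix_compose det_mul)
qed

lemma tangent_map_continuous:
  assumes f: "smooth_into X A std f" and c: "c \<in> A"
  shows "continuous_on {x \<in> std. f x \<in> cdom c} (\<lambda>x. tangent_map c std f x v)"
proof (unfold continuous_on_eq_continuous_within, intro ballI)
  let ?S = "{x \<in> std. f x \<in> cdom c}"
  fix x assume x: "x \<in> ?S"
  have "smooth_on ?S (cmap c \<circ> f)" using f c unfolding smooth_into_def by blast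
  then obtain W G where G: "open W" "x \<in> W" "\<And>k. Ck_on k W G" "\<And>y. y \<in> ?S \<Longrightarrow> y \<in> W \<Longrightarrow> G y = (cmap c \<circ> f) y"
    using smooth_onE x by blast
  obtain D where D: "\<And>y. y \<in> W \<Longrightarrow> (G has_derivative D y) (at y)" "\<And>v. continuous_on W (\<lambda>y. D y v)"
    using smooth_extension_derivative[OF G(1,3)] by metis
  have eq: "tangent_map c std f y = D y" if "y \<in> ?S" "y \<in> W" for y
  proof -
    have "((cmap c \<circ> f) has_derivative D y) (at y within ?S)"
      using has_derivative_within_extension[OF D(1)[OF that(2)] G(1) that(2,1), of "cmap c \<circ> f"] G(4) by blast
    then show ?thesis
      using at_within_chart_domain[OF f c, of y] tangent_map_has_derivative[OF f c, of y] that
        has_derivative_unique_std_simplex[of "cmap c \<circ> f" _ y] by force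
  qed
  have "continuous (at x within ?S) (\<lambda>y. D y v)"
    using D(2)[of v] G(1,2) by (meson continuous_on_eq_continuous_at continuous_at_imp_continuous_at_within)
  moreover obtain e where e: "e > 0" "ball x e \<subseteq> W" using G(1,2) open_contains_ball by blast
  moreover have "D y v = tangent_map c std f y v" if "y \<in> ?S" "dist y x < e" for y
  proof -
    have "y \<in> W" using e(2) that(2) by (auto simp: dist_commute)
    then show ?thesis using eq[OF that(1)] by simp
  qed
  ultimately show "continuous (at x within ?S) (\<lambda>x. tangent_map c std f x v)"
    using continuous_transform_within[of x ?S "\<lambda>y. D y v" e "\<lambda>x. tangent_map c std f x v"] x by blast
qed

text \<open>The sign of the determinant does not depend on the chart because the atlas is oriented, and it is
  locally constant because in one chart the determinant is continuous without zeros. The simplex is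
  connected.\<close>

lemma tangent_map_orientation:
  assumes f: "smooth_into X A std f"
    and inj: "\<And>c x. c \<in> A \<Longrightarrow> x \<in> std \<Longrightarrow> f x \<in> cdom c \<Longrightarrow> inj (tangent_map c std f x)"
  shows "(\<forall>x\<in>std. \<forall>c\<in>A. f x \<in> cdom c \<longrightarrow> 0 < det (matrix (tangent_map c std f x))) \<or>
         (\<forall>x\<in>std. \<forall>c\<in>A. f x \<in> cdom c \<longrightarrow> det (matrix (tangent_map c std f x)) < 0)"
proof -
  let ?d = "\<lambda>c x. det (matrix (tangent_map c std f x))"
  define P where "P x \<longleftrightarrow> (\<forall>c\<in>A. f x \<in> cdom c \<longrightarrow> 0 < ?d c x)" for x
  have P: "P x \<longleftrightarrow> 0 < ?d c x" if "x \<in> std" "c \<in> A" "f x \<in> cdom c" for x c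
    unfolding P_def using tangent_map_det_chart_change[OF f] that by blast
  have nz: "?d c x \<noteq> 0" if "x \<in> std" "c \<in> A" "f x \<in> cdom c" for x c
    using inj[OF that(2,1,3)] tangent_map_linear[OF f that(2,1,3)] by (simp add: det_nz_iff_inj)
  have loc: "eventually (\<lambda>b. P a = P b) (at a within std)" if a: "a \<in> std" for a
  proof -
    have "f a \<in> topspace X" using a continuous_map_image_subset_topspace[of "top_of_set std" X f] f by (auto simp: smooth_into_def)
    then obtain c where c: "c \<in> A" "f a \<in> cdom c" using chart_at by blast
    let ?S = "{x \<in> std. f x \<in> cdom c}"
    have "continuous_on ?S (\<lambda>x. ?d c x)"
      unfolding det_def matrix_def
      by (simp, intro continuous_intros tangent_map_continuous[OF f c(1)])
    then have "(?d c \<longlongrightarrow> ?d c a) (at a within ?S)" using a c by (simp add: continuous_on_def)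
    then have "(?d c \<longlongrightarrow> ?d c a) (at a within std)" using at_within_chart_domain[OF f c(1) a c(2)] by simp
    moreover have "eventually (\<lambda>b. b \<in> ?S) (at a within std)"
      using smooth_into_domain_open[OF f cdom_open[OF c(1)]] a c(2)
      by (auto simp: eventually_at_topological openin_open)
    ultimately show ?thesis
    proof (cases "0 < ?d c a")
      case True
      then have "eventually (\<lambda>b. 0 < ?d c b) (at a within std)"
        using \<open>(?d c \<longlongrightarrow> ?d c a) (at a within std)\<close> order_tendstoD(1) by blast
      with \<open>eventually (\<lambda>b. b \<in> ?S) (at a within std)\<close> show ?thesis
        by eventually_elim (use P[OF a c] P[OF _ c(1)] True in auto)
    next
      case False
      then have "?d c a < 0" using nz[OF a c] by simp
      then have "eventually (\<lambda>b. ?d c b < 0) (at a within std)"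
        using \<open>(?d c \<longlongrightarrow> ?d c a) (at a within std)\<close> order_tendstoD(2) by blast
      with \<open>eventually (\<lambda>b. b \<in> ?S) (at a within std)\<close> show ?thesis
        by eventually_elim (use P[OF a c] P[OF _ c(1)] False in auto)
    qed
  qed
  have "P x = P 0" if "x \<in> std" for x
    using connected_local_const[OF convex_connected[OF convex_std_simplex_UNIV] that zero_in_std_simplex] loc by blast
  then show ?thesis using P nz by (metis linorder_neqE_linordered_idom)
qed

end

section \<open>Diffeomorphisms of the standard simplex onto subsets\<close>

text \<open>The conditions of \<^const>\<open>oriented_diffeo\<close> except for the orientation.\<close>

definition (in atlas_manifold) simplex_diffeo :: "(real ^ 'n \<Rightarrow> 'a) \<Rightarrow> 'a set \<Rightarrow> bool" where
  "simplex_diffeo f T \<longleftrightarrow> bij_betw f std T \<and> smooth_into X A std f \<and>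
     (\<forall>c\<in>A. smooth_on (cmap c ` (T \<inter> cdom c)) (inv_into std f \<circ> cinv c))"

context atlas_manifold begin

text \<open>Differentiating \<open>f\<^sup>-\<^sup>1 \<circ> f = id\<close>. Whatever derivative of the inverse the choice operator picks
  within \<open>T\<close>, it is determined by this equation.\<close>

lemma simplex_diffeo_derivatives:
  assumes f: "simplex_diffeo f T" and x: "x \<in> std" and c: "c \<in> A" "f x \<in> cdom c"
  defines "D \<equiv> frechet_derivative (inv_into std f \<circ> cinv c) (at (cmap c (f x)) within cmap c ` (T \<inter> cdom c))"
  shows "D \<circ> tangent_map c std f x = id" and "tangent_map c std f x \<circ> D = id"
proof -
  have sm: "smooth_into X A std f" and bij: "bij_betw f std T"
    and inv: "smooth_on (cmap c ` (T \<inter> cdom c)) (inv_into std f \<circ> cinv c)"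
    using f c unfolding simplex_diffeo_def by auto
  have fT: "f y \<in> T" if "y \<in> std" for y using bij that by (auto simp: bij_betw_def)
  have D: "((inv_into std f \<circ> cinv c) has_derivative D) (at (cmap c (f x)) within cmap c ` (T \<inter> cdom c))"
    unfolding D_def using fT[OF x] c by (intro smooth_on_has_derivative[OF inv]) auto
  have "((\<lambda>y. y) has_derivative D \<circ> tangent_map c std f x) (at x within std)"
    by (rule chain_through_chart[OF sm c(1) x c(2) _ D])
      (use fT bij in \<open>auto simp: cinv_cmap[OF c(1)] bij_betw_def\<close>)
  then have "D \<circ> tangent_map c std f x = (\<lambda>y. y)"
    by (rule has_derivative_unique_std_simplex) (auto intro: x derivative_intros)
  then show *: "D \<circ> tangent_map c std f x = id" by (simp add: id_def)
  have "linear D" using D has_derivative_linear by blast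
  then show "tangent_map c std f x \<circ> D = id"
    using * linear_inverse_left[OF \<open>linear D\<close> tangent_map_linear[OF sm c(1) x c(2)]] by blast
qed

end

section \<open>Smooth embeddings of open sets\<close>

locale embedded_open = atlas_manifold X A for X :: "'a topology" and A :: "('a, 'n::finite) chart set" +
  fixes U :: "'a set" and k :: nat and \<phi> :: "'a \<Rightarrow> nat \<Rightarrow> real"
  assumes U: "openin X U" and embedding: "smooth_embedding X A U k \<phi>"
begin

lemma topspace_U: "topspace (subtopology X U) = U"
  using openin_subset[OF U] by (auto simp: topspace_subtopology)

lemma phi_homeo: "homeomorphic_map (subtopology X U) (subtopology (Euclidean_space k) (\<phi> ` U)) \<phi>"
  using embedding topspace_U unfolding smooth_embedding_def embedding_map_def by simp

lemma phi_inj: "inj_on \<phi> U"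
  using phi_homeo topspace_U by (simp add: homeomorphic_eq_everything_map)

text \<open>The differential of the \<open>j\<close>-th component of \<open>\<phi>\<close> at \<open>p\<close>, in the coordinates of the chart \<open>c\<close>.\<close>

definition dphi :: "('a, 'n) chart \<Rightarrow> 'a \<Rightarrow> nat \<Rightarrow> real ^ 'n \<Rightarrow> real" where
  "dphi c p j = frechet_derivative (\<lambda>x. \<phi> (cinv c x) j) (at (cmap c p) within cmap c ` (U \<inter> cdom c))"

lemma coordinate_smooth:
  "c \<in> A \<Longrightarrow> j < k \<Longrightarrow> smooth_on (cmap c ` (U \<inter> cdom c)) (\<lambda>x. \<phi> (cinv c x) j)"
  using embedding unfolding smooth_embedding_def by blast

lemma dphi_has_derivative:
  assumes "c \<in> A" and "j < k" and "p \<in> U" and "p \<in> cdom c"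
  shows "((\<lambda>x. \<phi> (cinv c x) j) has_derivative dphi c p j) (at (cmap c p) within cmap c ` (U \<inter> cdom c))"
  unfolding dphi_def using assms by (intro smooth_on_has_derivative coordinate_smooth) auto

text \<open>Smoothness on a manifold with corners is defined by extensions across the boundary. Uniqueness
  of derivatives in corners identifies the derivative of any extension with the differential of
  \<open>\<phi>\<close>, which transports the immersion property to the extension.\<close>

lemma dphi_extension:
  assumes c: "c \<in> A" and j: "j < k" and p: "p \<in> U" "p \<in> cdom c"
    and W: "open W" "cmap c p \<in> W" and D: "(\<Phi> has_derivative D) (at (cmap c p))"
    and eq: "\<And>q. q \<in> U \<Longrightarrow> q \<in> cdom c \<Longrightarrow> cmap c q \<in> W \<Longrightarrow> \<Phi> (cmap c q) = \<phi> q j"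
  shows "D = dphi c p j"
proof -
  let ?S = "cmap c ` (U \<inter> cdom c)"
  obtain s where s: "is_chart X s c" using chart_obtain[OF c] .
  have S_open: "openin (top_of_set (corner_model s)) ?S"
    using chart_image_open_corner[OF s c openin_Int[OF U cdom_open[OF c]]] by simp
  have y: "cmap c p \<in> ?S" using p by auto
  have "((\<lambda>x. \<phi> (cinv c x) j) has_derivative D) (at (cmap c p) within ?S)"
    by (rule has_derivative_within_extension[OF D W y]) (use eq in \<open>auto simp: cinv_cmap[OF c]\<close>)
  from has_derivative_unique_corner[OF this dphi_has_derivative[OF c j p] S_open y] show ?thesis .
qed

text \<open>Local extensions of all components of \<open>\<phi>\<close> to a common neighbourhood, together with a left inverse
  of the differential at the centre, which exists because \<open>\<phi>\<close> is an immersion.\<close>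

lemma chart_extension:
  assumes c: "c \<in> A" and p0: "p0 \<in> U" "p0 \<in> cdom c"
  obtains W \<Phi> D m where "open W" "cmap c p0 \<in> W" "\<And>j r. j < k \<Longrightarrow> Ck_on r W (\<Phi> j)"
    "\<And>j p. j < k \<Longrightarrow> p \<in> U \<Longrightarrow> p \<in> cdom c \<Longrightarrow> cmap c p \<in> W \<Longrightarrow> \<Phi> j (cmap c p) = \<phi> p j"
    "\<And>j y. j < k \<Longrightarrow> y \<in> W \<Longrightarrow> (\<Phi> j has_derivative D j y) (at y)"
    "\<And>j v. j < k \<Longrightarrow> continuous_on W (\<lambda>y. D j y v)"
    "\<And>v. v = (\<Sum>j<k. D j (cmap c p0) v *\<^sub>R m j)"
proof -
  let ?S = "cmap c ` (U \<inter> cdom c)" and ?y = "cmap c p0"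
  have y: "?y \<in> ?S" using p0 by auto
  have "\<exists>W F. open W \<and> ?y \<in> W \<and> (\<forall>r. Ck_on r W F) \<and> (\<forall>y\<in>?S \<inter> W. F y = \<phi> (cinv c y) j)" if "j < k" for j
    using coordinate_smooth[OF c that] y unfolding smooth_on_def by blast
  then obtain W \<Phi> where W: "\<And>j. j < k \<Longrightarrow> open (W j)" "\<And>j. j < k \<Longrightarrow> ?y \<in> W j"
    "\<And>j r. j < k \<Longrightarrow> Ck_on r (W j) (\<Phi> j)" "\<And>j y. j < k \<Longrightarrow> y \<in> ?S \<Longrightarrow> y \<in> W j \<Longrightarrow> \<Phi> j y = \<phi> (cinv c y) j"
    by (metis IntI)
  have "\<exists>D. (\<forall>y\<in>W j. (\<Phi> j has_derivative D y) (at y)) \<and> (\<forall>v. continuous_on (W j) (\<lambda>y. D y v))" if "j < k" for j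
    using smooth_extension_derivative[OF W(1)[OF that] W(3)[OF that]] by metis
  then obtain D where D: "\<And>j y. j < k \<Longrightarrow> y \<in> W j \<Longrightarrow> (\<Phi> j has_derivative D j y) (at y)"
    "\<And>j v. j < k \<Longrightarrow> continuous_on (W j) (\<lambda>y. D j y v)" by metis
  have D_eq: "D j ?y = dphi c p0 j" if "j < k" for j
    by (rule dphi_extension[OF c that p0 W(1,2)[OF that] D(1)[OF that W(2)[OF that]]])
      (use W(4)[OF that] in \<open>auto simp: cinv_cmap[OF c]\<close>)
  have lin: "linear (D j ?y)" if "j < k" for j
    using D(1)[OF that W(2)[OF that]] has_derivative_linear by blast
  have inj: "v = 0" if "\<And>j. j < k \<Longrightarrow> D j ?y v = 0" for v
  proof -
    have "\<forall>j<k. frechet_derivative (\<lambda>x. \<phi> (cinv c x) j) (at ?y within ?S) v = 0"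
      using that D_eq by (auto simp: dphi_def)
    then show ?thesis using embedding c p0 unfolding smooth_embedding_def by blast
  qed
  obtain m where m: "\<And>v. v = (\<Sum>j<k. D j ?y v *\<^sub>R m j)"
    using linear_functionals_dual_frame[of k "\<lambda>j. D j ?y", OF lin inj] by blast
  let ?W = "\<Inter>j<k. W j"
  have sub: "?W \<subseteq> W j" if "j < k" for j using that by auto
  show ?thesis
  proof (rule that[of ?W \<Phi> D m])
    show "open ?W" using W(1) by (intro open_INT) auto
    show "?y \<in> ?W" using W(2) by auto
    show "Ck_on r ?W (\<Phi> j)" if "j < k" for j r using Ck_on_subset[OF W(3)[OF that] sub[OF that]] .
    show "\<Phi> j (cmap c p) = \<phi> p j" if "j < k" "p \<in> U" "p \<in> cdom c" "cmap c p \<in> ?W" for j p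
      using W(4)[of j "cmap c p"] that by (auto simp: cinv_cmap[OF c])
    show "(\<Phi> j has_derivative D j y) (at y)" if "j < k" "y \<in> ?W" for j y using D(1) that by auto
    show "continuous_on ?W (\<lambda>y. D j y v)" if "j < k" for j v
      using continuous_on_subset[OF D(2)[OF that] sub[OF that]] .
  qed (rule m)
qed

text \<open>Let \<open>m\<close> be a linear left inverse of \<open>d\<phi>\<close> at \<open>p0\<close> and extend \<open>\<phi>\<close> across the boundary. Then
  \<open>\<Psi> = m \<circ> \<phi>\<close>, read in the chart, has the identity as derivative at \<open>p0\<close>, so it has a smooth
  local inverse \<open>\<Gamma>\<close>. Hence the chart itself is \<open>\<Gamma> \<circ> m \<circ> \<phi>\<close> near \<open>p0\<close>.\<close>

lemma chart_from_embedding: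
  assumes c: "c \<in> A" and p0: "p0 \<in> U" "p0 \<in> cdom c"
  obtains O1 O2 \<Gamma> m where "open O1" "cmap c p0 \<in> O1" "open O2" "\<And>r. Ck_on r O2 \<Gamma>"
    "\<And>p. p \<in> U \<Longrightarrow> p \<in> cdom c \<Longrightarrow> cmap c p \<in> O1 \<Longrightarrow>
       (\<Sum>j<k. \<phi> p j *\<^sub>R (m j :: real ^ 'n)) \<in> O2 \<and> \<Gamma> (\<Sum>j<k. \<phi> p j *\<^sub>R m j) = cmap c p"
proof -
  obtain W \<Phi> D m where W: "open W" "cmap c p0 \<in> W" "\<And>j r. j < k \<Longrightarrow> Ck_on r W (\<Phi> j)"
    and \<Phi>: "\<And>j p. j < k \<Longrightarrow> p \<in> U \<Longrightarrow> p \<in> cdom c \<Longrightarrow> cmap c p \<in> W \<Longrightarrow> \<Phi> j (cmap c p) = \<phi> p j"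
    and D: "\<And>j y. j < k \<Longrightarrow> y \<in> W \<Longrightarrow> (\<Phi> j has_derivative D j y) (at y)"
    and "\<And>j v. j < k \<Longrightarrow> continuous_on W (\<lambda>y. D j y v)"
    and m: "\<And>v. v = (\<Sum>j<k. D j (cmap c p0) v *\<^sub>R m j)"
    by (rule chart_extension[OF c p0]) blast
  define \<Psi> where "\<Psi> y = (\<Sum>j<k. \<Phi> j y *\<^sub>R m j)" for y
  have sm: "Ck_on r W \<Psi>" for r
    unfolding \<Psi>_def by (intro Ck_on_sum Ck_on_scaleR Ck_on_const W(3)) simp
  have "(\<Psi> has_derivative (\<lambda>v. \<Sum>j<k. D j (cmap c p0) v *\<^sub>R m j)) (at (cmap c p0))"
    unfolding \<Psi>_def by (intro has_derivative_sum has_derivative_scaleR_left D W(2)) simp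
  then have "(\<Psi> has_derivative (\<lambda>v. v)) (at (cmap c p0))" by (simp only: m[symmetric])
  then have inj: "inj D'" if "(\<Psi> has_derivative D') (at (cmap c p0))" for D'
    using has_derivative_unique[OF that] by simp
  obtain O1 O2 \<Gamma> where O: "open O1" "O1 \<subseteq> W" "cmap c p0 \<in> O1" "open O2" "\<Psi> ` O1 \<subseteq> O2"
    "\<And>y. y \<in> O1 \<Longrightarrow> \<Gamma> (\<Psi> y) = y" "\<And>r. Ck_on r O2 \<Gamma>"
    by (rule smooth_local_inverse[OF W(1,2) sm inj]) (assumption, blast)
  have "(\<Sum>j<k. \<phi> p j *\<^sub>R m j) = \<Psi> (cmap c p)" if "p \<in> U" "p \<in> cdom c" "cmap c p \<in> O1" for p
    unfolding \<Psi>_def using \<Phi>[OF _ that(1,2)] O(2) that(3) by (intro sum.cong) auto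
  then show ?thesis using O by (intro that[of O1 O2 \<Gamma> m]) auto
qed

end

section \<open>Simplices with affine image under an embedding\<close>

locale affine_simplex = embedded_open X A U k \<phi>
  for X :: "'a topology" and A :: "('a, 'n::finite) chart set" and U k \<phi> +
  fixes T :: "'a set" and F :: "real ^ 'n \<Rightarrow> nat \<Rightarrow> real"
  assumes TU: "T \<subseteq> U" and affine: "affine_into k F" and F_inj: "inj F"
    and F_image: "F ` std = \<phi> ` T"
begin

abbreviation "param \<equiv> inv_into T \<phi> \<circ> F"

lemma phi_param: "x \<in> std \<Longrightarrow> \<phi> (param x) = F x"
  and param_in: "x \<in> std \<Longrightarrow> param x \<in> T"
  using F_image by (auto intro!: f_inv_into_f inv_into_into)

lemma param_bij: "bij_betw param std T"
proof -
  have "inj_on param std"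
  proof (rule inj_onI)
    fix x y assume "x \<in> std" "y \<in> std" "param x = param y"
    then have "F x = F y" using phi_param[of x] phi_param[of y] by simp
    then show "x = y" using F_inj by (simp add: inj_eq)
  qed
  moreover have "p \<in> param ` std" if p: "p \<in> T" for p
  proof -
    have "\<phi> p \<in> F ` std" using F_image p by simp
    then obtain x where x: "x \<in> std" "F x = \<phi> p" by auto
    then have "param x = p"
      using phi_param[OF x(1)] param_in[OF x(1)] TU p by (intro inj_onD[OF phi_inj]) auto
    then show ?thesis using x(1) by blast
  qed
  ultimately show ?thesis using param_in unfolding bij_betw_def by blast
qed

lemma param_continuous: "continuous_map (top_of_set std) X param"
proof -
  obtain \<psi> where \<psi>: "homeomorphic_maps (subtopology X U) (subtopology (Euclidean_space k) (\<phi> ` U)) \<phi> \<psi>"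
    using phi_homeo homeomorphic_map_maps by blast
  have "continuous_on std (\<lambda>x. F x j)" for j
    using affine_into_smooth[OF affine, of 0 std j] by simp
  then have "continuous_map (top_of_set std) (Euclidean_space k) F"
    using affine unfolding Euclidean_space_def affine_into_def
    by (auto simp: continuous_map_in_subtopology continuous_map_componentwise_UNIV)
  moreover have "F ` std \<subseteq> \<phi> ` U" using F_image TU by blast
  ultimately have "continuous_map (top_of_set std) (subtopology (Euclidean_space k) (\<phi> ` U)) F"
    by (auto simp: continuous_map_in_subtopology)
  moreover have "continuous_map (subtopology (Euclidean_space k) (\<phi> ` U)) X \<psi>"
    using \<psi> by (simp add: homeomorphic_maps_def continuous_map_in_subtopology)
  ultimately have "continuous_map (top_of_set std) X (\<psi> \<circ> F)"
    by (rule continuous_map_compose)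
  moreover have "(\<psi> \<circ> F) x = param x" if "x \<in> std" for x
  proof -
    have "param x \<in> U" using param_in[OF that] TU by blast
    then have "\<psi> (\<phi> (param x)) = param x" using \<psi> topspace_U by (simp add: homeomorphic_maps_def)
    then show ?thesis using phi_param[OF that] by simp
  qed
  ultimately show ?thesis by (rule continuous_map_eq) simp
qed

text \<open>Writing the chart near \<open>param x\<close> as \<open>\<Gamma> \<circ> m \<circ> \<phi>\<close> (\<open>chart_from_embedding\<close>) turns
  \<open>cmap c \<circ> param\<close> into \<open>\<Gamma> \<circ> m \<circ> F\<close>, which is smooth on an open set. Continuity of \<open>param\<close>, which
  comes from \<open>\<phi>\<close> being a homeomorphism onto its image, keeps nearby points where this is valid.\<close>

lemma param_smooth: "smooth_into X A std param"
  unfolding smooth_into_def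
proof (intro conjI ballI param_continuous)
  fix c assume c: "c \<in> A"
  let ?S = "{x \<in> std. param x \<in> cdom c}"
  show "smooth_on ?S (cmap c \<circ> param)"
    unfolding smooth_on_def
  proof
    fix x assume x: "x \<in> ?S"
    have pU: "param y \<in> U" if "y \<in> std" for y using param_in[OF that] TU by blast
    have px: "param x \<in> U" "param x \<in> cdom c" using x pU by auto
    obtain O1 O2 \<Gamma> and m :: "nat \<Rightarrow> real ^ 'n"
      where O: "open O1" "cmap c (param x) \<in> O1" "open O2" "\<And>r. Ck_on r O2 \<Gamma>"
      and \<Gamma>: "\<And>p. p \<in> U \<Longrightarrow> p \<in> cdom c \<Longrightarrow> cmap c p \<in> O1 \<Longrightarrow>
       (\<Sum>j<k. \<phi> p j *\<^sub>R m j) \<in> O2 \<and> \<Gamma> (\<Sum>j<k. \<phi> p j *\<^sub>R m j) = cmap c p"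
      by (rule chart_from_embedding[OF c px]) blast
    define \<Lambda> where "\<Lambda> y = (\<Sum>j<k. F y j *\<^sub>R m j)" for y
    have \<Lambda>: "Ck_on r R \<Lambda>" for r R
      unfolding \<Lambda>_def by (intro Ck_on_sum Ck_on_scaleR Ck_on_const affine_into_smooth[OF affine])
    have \<Lambda>\<phi>: "\<Lambda> y = (\<Sum>j<k. \<phi> (param y) j *\<^sub>R m j)" if "y \<in> std" for y
      unfolding \<Lambda>_def phi_param[OF that] ..
    have "openin (top_of_set std) {y \<in> std. param y \<in> {p \<in> cdom c. cmap c p \<in> O1}}"
      using openin_continuous_map_preimage[OF param_continuous chart_preimage_open[OF c O(1)]] by simp
    then obtain W1 where W1: "open W1" "{y \<in> std. param y \<in> {p \<in> cdom c. cmap c p \<in> O1}} = std \<inter> W1"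
      by (auto simp: openin_open)
    define W where "W = W1 \<inter> \<Lambda> -` O2"
    have "open (\<Lambda> -` O2)" using \<Lambda>[of 0 UNIV] by (intro open_vimage O(3)) simp
    then have "open W" using W1(1) unfolding W_def by blast
    have inO1: "param y \<in> cdom c" "cmap c (param y) \<in> O1" if "y \<in> std" "y \<in> W1" for y
      using W1(2) that by blast+
    have ext: "\<Lambda> y \<in> O2 \<and> \<Gamma> (\<Lambda> y) = cmap c (param y)" if "y \<in> std" "y \<in> W1" for y
      using \<Gamma>[OF pU[OF that(1)] inO1[OF that]] \<Lambda>\<phi>[OF that(1)] by simp
    have "x \<in> W1" using W1(2) x O(2) by blast
    then have "x \<in> W" using ext[of x] x by (auto simp: W_def)
    moreover have "Ck_on r W (\<lambda>y. \<Gamma> (\<Lambda> y))" for r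
      by (rule Ck_on_compose[OF _ \<Lambda> O(4)]) (auto simp: W_def)
    moreover have "\<forall>y\<in>?S \<inter> W. \<Gamma> (\<Lambda> y) = (cmap c \<circ> param) y"
      using ext by (simp add: W_def)
    ultimately show "\<exists>W G. open W \<and> x \<in> W \<and> (\<forall>r. Ck_on r W G) \<and> (\<forall>y\<in>?S \<inter> W. G y = (cmap c \<circ> param) y)"
      using \<open>open W\<close> by blast
  qed
qed

text \<open>With a left inverse \<open>m\<close> of the linear part of \<open>F\<close>, the inverse of \<open>param\<close> is
  \<open>p \<mapsto> m (\<phi> p - F 0)\<close>, so it extends as far as \<open>\<phi>\<close> does.\<close>

lemma param_inverse_smooth:
  assumes c: "c \<in> A"
  shows "smooth_on (cmap c ` (T \<inter> cdom c)) (inv_into std param \<circ> cinv c)"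
  unfolding smooth_on_def
proof
  let ?S = "cmap c ` (T \<inter> cdom c)"
  fix y0 assume "y0 \<in> ?S"
  then obtain p0 where p0: "p0 \<in> T" "p0 \<in> cdom c" "y0 = cmap c p0" by auto
  then have "p0 \<in> U" using TU by auto
  obtain W \<Phi> D m where W: "open W" "cmap c p0 \<in> W" "\<And>j r. j < k \<Longrightarrow> Ck_on r W (\<Phi> j)"
    and \<Phi>: "\<And>j p. j < k \<Longrightarrow> p \<in> U \<Longrightarrow> p \<in> cdom c \<Longrightarrow> cmap c p \<in> W \<Longrightarrow> \<Phi> j (cmap c p) = \<phi> p j"
    and "\<And>j y. j < k \<Longrightarrow> y \<in> W \<Longrightarrow> (\<Phi> j has_derivative D j y) (at y)"
    and "\<And>j v. j < k \<Longrightarrow> continuous_on W (\<lambda>y. D j y v)"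
    and "\<And>v. v = (\<Sum>j<k. D j (cmap c p0) v *\<^sub>R m j)"
    by (rule chart_extension[OF c \<open>p0 \<in> U\<close> p0(2)]) blast
  obtain m where m: "\<And>v. v = (\<Sum>j<k. (F v j - F 0 j) *\<^sub>R m j)"
    by (rule linear_functionals_dual_frame[of k "\<lambda>j v. F v j - F 0 j",
          OF affine_into_functionals(1)[OF affine] affine_into_functionals(2)[OF affine F_inj]]) blast+
  let ?G = "\<lambda>y. \<Sum>j<k. (\<Phi> j y + - F 0 j) *\<^sub>R m j"
  have "Ck_on r W ?G" for r
    by (intro Ck_on_sum Ck_on_scaleR Ck_on_add Ck_on_const W(3)) simp
  moreover have "?G y = (inv_into std param \<circ> cinv c) y" if y: "y \<in> ?S \<inter> W" for y
  proof -
    obtain p where p: "p \<in> T" "p \<in> cdom c" "y = cmap c p" using y by auto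
    define x where "x = inv_into std param p"
    have x: "x \<in> std" "param x = p"
      using p(1) bij_betw_imp_surj_on[OF param_bij] inv_into_into[of p param std] f_inv_into_f[of p param std]
      unfolding x_def by simp_all
    have "\<Phi> j y = F x j" if "j < k" for j
      using \<Phi>[OF that, of p] p TU y phi_param[OF x(1)] x(2) by auto
    then have "?G y = (\<Sum>j<k. (F x j - F 0 j) *\<^sub>R m j)" by (intro sum.cong) auto
    then show ?thesis using m[of x] p by (simp add: x_def cinv_cmap[OF c])
  qed
  ultimately show "\<exists>W G. open W \<and> y0 \<in> W \<and> (\<forall>r. Ck_on r W G) \<and> (\<forall>y\<in>?S \<inter> W. G y = (inv_into std param \<circ> cinv c) y)"
    using W(1,2) p0(3) by blast
qed

lemma param_diffeo: "simplex_diffeo param T"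
  unfolding simplex_diffeo_def using param_bij param_smooth param_inverse_smooth by blast

text \<open>Differentiating \<open>\<phi> \<circ> param = F\<close>.\<close>

lemma dphi_tangent_map:
  assumes c: "c \<in> A" and x: "x \<in> std" "param x \<in> cdom c" and j: "j < k"
  shows "dphi c (param x) j (tangent_map c std param x w) = F w j - F 0 j"
proof -
  have "param x \<in> U" using param_in[OF x(1)] TU by blast
  from dphi_has_derivative[OF c j this x(2)]
  have "((\<lambda>x. F x j) has_derivative dphi c (param x) j \<circ> tangent_map c std param x) (at x within std)"
    by (rule chain_through_chart[OF param_smooth c x, rotated])
      (use param_in TU phi_param in \<open>auto simp: cinv_cmap[OF c]\<close>)
  from has_derivative_unique_std_simplex[OF this affine_into_has_derivative[OF affine] x(1)]
  show ?thesis by (metis comp_apply)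
qed

end

section \<open>Equivalence of the metric and the embedding metric on compact sets\<close>

context embedded_open begin

text \<open>The norm of \<open>v\<close> in the pullback of the Euclidean metric by \<open>\<phi>\<close>.\<close>

definition dphi_norm :: "('a, 'n) chart \<Rightarrow> 'a \<Rightarrow> real ^ 'n \<Rightarrow> real" where
  "dphi_norm c p v = L2_set (\<lambda>j. dphi c p j v) {..<k}"

text \<open>One chart around \<open>p\<close> is enough: both norms are invariant under chart changes, and the invariance
  is only used for vectors tangent to a parametrized simplex (\<open>comparable_tangent_map\<close>), where it
  follows from the chain rule.\<close>

definition comparable :: "('a, 'n) form_field \<Rightarrow> real \<Rightarrow> 'a \<Rightarrow> bool" where
  "comparable g B p \<longleftrightarrow> (\<exists>c\<in>A. p \<in> cdom c \<and>
     (\<forall>v. dphi_norm c p v \<le> B * sqrt (g c p v v) \<and> sqrt (g c p v v) \<le> B * dphi_norm c p v))"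

lemma comparable_mono:
  assumes "comparable g B p" and "B \<le> B'" and "0 < B"
  shows "comparable g B' p"
proof -
  obtain c where c: "c \<in> A" "p \<in> cdom c" and
    *: "\<And>v. dphi_norm c p v \<le> B * sqrt (g c p v v) \<and> sqrt (g c p v v) \<le> B * dphi_norm c p v"
    using assms(1) unfolding comparable_def by blast
  have "dphi_norm c p v \<le> B' * sqrt (g c p v v) \<and> sqrt (g c p v v) \<le> B' * dphi_norm c p v" for v
  proof -
    have n: "0 \<le> dphi_norm c p v" unfolding dphi_norm_def by (rule L2_set_nonneg)
    with *[of v] have "0 \<le> B * sqrt (g c p v v)" by linarith
    with \<open>0 < B\<close> have "0 \<le> sqrt (g c p v v)" by (simp add: zero_le_mult_iff)
    with n assms(2) *[of v] show ?thesis by (meson mult_right_mono order_trans)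
  qed
  with c show ?thesis unfolding comparable_def by blast
qed

text \<open>In the coordinates of a chart around \<open>p0\<close> both \<open>g\<close> and the pullback of the Euclidean metric are
  continuous fields of positive definite forms, so near \<open>p0\<close> each is equivalent to the square of
  the coordinate norm.\<close>

lemma comparable_near:
  assumes g: "riemannian_metric A g" and p0: "p0 \<in> U"
  shows "\<exists>O' B. openin X O' \<and> p0 \<in> O' \<and> 0 < B \<and> (\<forall>p\<in>O'. comparable g B p)"
proof -
  have "p0 \<in> topspace X" using p0 openin_subset[OF U] by blast
  then obtain c where c: "c \<in> A" "p0 \<in> cdom c" using chart_at by blast
  let ?y = "cmap c p0"
  obtain W \<Phi> D m where W: "open W" "?y \<in> W" and "\<And>j r. j < k \<Longrightarrow> Ck_on r W (\<Phi> j)"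
    and \<Phi>: "\<And>j p. j < k \<Longrightarrow> p \<in> U \<Longrightarrow> p \<in> cdom c \<Longrightarrow> cmap c p \<in> W \<Longrightarrow> \<Phi> j (cmap c p) = \<phi> p j"
    and D: "\<And>j y. j < k \<Longrightarrow> y \<in> W \<Longrightarrow> (\<Phi> j has_derivative D j y) (at y)"
    and contD: "\<And>j v. j < k \<Longrightarrow> continuous_on W (\<lambda>y. D j y v)"
    and m: "\<And>v. v = (\<Sum>j<k. D j ?y v *\<^sub>R m j)"
    by (rule chart_extension[OF c(1) p0 c(2)]) blast
  have D_eq: "D j (cmap c p) = dphi c p j" if "j < k" "p \<in> U" "p \<in> cdom c" "cmap c p \<in> W" for j p
    by (rule dphi_extension[OF c(1) that(1-3) W(1) that(4) D[OF that(1,4)] \<Phi>[OF that(1)]])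
  define B1 where "B1 y u v = (\<Sum>j<k. D j y u * D j y v)" for y u v
  define B2 where "B2 y = g c (cinv c y)" for y
  have linD: "linear (D j y)" if "j < k" "y \<in> W" for j y
    using D[OF that] has_derivative_linear by blast
  have exp1: "B1 y v v = (\<Sum>a\<in>Basis. \<Sum>b\<in>Basis. (v \<bullet> a) * (v \<bullet> b) * B1 y a b)" if "y \<in> W" for y v
  proof (rule bilinear_form_expand)
    show "linear (\<lambda>u. B1 y u v)" for v
      unfolding B1_def using linD[OF _ that]
      by (intro linearI) (auto simp: linear_add linear_scale sum.distrib sum_distrib_left algebra_simps)
    show "linear (B1 y u)" for u
      unfolding B1_def using linD[OF _ that]
      by (intro linearI) (auto simp: linear_add linear_scale sum.distrib sum_distrib_left algebra_simps)
  qed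
  have cont1: "continuous_on W (\<lambda>y. B1 y a b)" for a b
    unfolding B1_def by (intro continuous_intros contD) auto
  have pos1: "0 < B1 ?y v v" if "v \<noteq> 0" for v
  proof -
    have "\<exists>j<k. D j ?y v \<noteq> 0"
    proof (rule ccontr)
      assume "\<not> (\<exists>j<k. D j ?y v \<noteq> 0)"
      then have "(\<Sum>j<k. D j ?y v *\<^sub>R m j) = 0" by simp
      then show False using m[of v] that by simp
    qed
    then show ?thesis unfolding B1_def by (auto intro!: sum_pos2 simp: zero_less_mult_iff linorder_neq_iff)
  qed
  obtain m1 M1 e1 where 1: "0 < m1" "0 < M1" "0 < e1"
    "\<And>y v. y \<in> W \<Longrightarrow> dist y ?y < e1 \<Longrightarrow> m1 * (norm v)\<^sup>2 \<le> B1 y v v \<and> B1 y v v \<le> M1 * (norm v)\<^sup>2"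
    by (rule forms_comparable_near[of W B1 ?y, OF exp1 cont1 pos1 W(2)]) blast+
  have ip: "inner_product_on UNIV (B2 y)" if "y \<in> cimg c" for y
    using g c(1) that unfolding riemannian_metric_def B2_def by (auto simp: inv_into_into)
  have exp2: "B2 y v v = (\<Sum>a\<in>Basis. \<Sum>b\<in>Basis. (v \<bullet> a) * (v \<bullet> b) * B2 y a b)" if "y \<in> cimg c" for y v
    using inner_product_on_linear[OF ip[OF that]] by (intro bilinear_form_expand)
  have cont2: "continuous_on (cimg c) (\<lambda>y. B2 y a b)" for a b
    using g c(1) unfolding riemannian_metric_def B2_def by (intro smooth_on_continuous) blast
  have y: "?y \<in> cimg c" using c(2) by blast
  have pos2: "0 < B2 ?y v v" if "v \<noteq> 0" for v
    using ip[OF \<open>?y \<in> cimg c\<close>] that unfolding inner_product_on_def by blast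
  obtain m2 M2 e2 where 2: "0 < m2" "0 < M2" "0 < e2"
    "\<And>y v. y \<in> cimg c \<Longrightarrow> dist y ?y < e2 \<Longrightarrow> m2 * (norm v)\<^sup>2 \<le> B2 y v v \<and> B2 y v v \<le> M2 * (norm v)\<^sup>2"
    by (rule forms_comparable_near[of "cimg c" B2 ?y, OF exp2 cont2 pos2 y]) blast+
  define B where "B = sqrt (M1 / m2) + sqrt (M2 / m1)"
  have B: "0 < B" using 1 2 by (simp add: B_def add_pos_pos)
  define O' where "O' = U \<inter> {p \<in> cdom c. cmap c p \<in> W \<inter> ball ?y (min e1 e2)}"
  have "openin X O'"
    unfolding O'_def by (intro openin_Int U chart_preimage_open[OF c(1)] open_Int W(1) open_ball)
  moreover have "p0 \<in> O'" using p0 c(2) W(2) 1(3) 2(3) by (simp add: O'_def)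
  moreover have "comparable g B p" if "p \<in> O'" for p
  proof -
    let ?z = "cmap c p"
    have p: "p \<in> U" "p \<in> cdom c" "?z \<in> W" "dist ?z ?y < e1" "dist ?z ?y < e2"
      using that by (auto simp: O'_def dist_commute)
    have "dphi_norm c p v \<le> B * sqrt (g c p v v) \<and> sqrt (g c p v v) \<le> B * dphi_norm c p v" for v
    proof -
      have n: "dphi_norm c p v = sqrt (B1 ?z v v)"
        using D_eq[OF _ p(1-3)] by (simp add: dphi_norm_def L2_set_def B1_def power2_eq_square)
      have gz: "g c p v v = B2 ?z v v" by (simp add: B2_def cinv_cmap[OF c(1) p(2)])
      have b1: "m1 * (norm v)\<^sup>2 \<le> B1 ?z v v" "B1 ?z v v \<le> M1 * (norm v)\<^sup>2" using 1(4)[OF p(3,4)] by auto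
      have b2: "m2 * (norm v)\<^sup>2 \<le> B2 ?z v v" "B2 ?z v v \<le> M2 * (norm v)\<^sup>2" using 2(4)[of ?z v] p by auto
      have "(norm v)\<^sup>2 \<le> B2 ?z v v / m2" "(norm v)\<^sup>2 \<le> B1 ?z v v / m1"
        using b1 b2 1 2 by (simp_all add: field_simps)
      note this[THEN mult_left_mono, OF less_imp_le]
      then have "M1 * (norm v)\<^sup>2 \<le> M1 * (B2 ?z v v / m2)" "M2 * (norm v)\<^sup>2 \<le> M2 * (B1 ?z v v / m1)"
        using 1(2) 2(2) by blast+
      with b1 b2 have "B1 ?z v v \<le> (M1 / m2) * B2 ?z v v" "B2 ?z v v \<le> (M2 / m1) * B1 ?z v v"
        by auto
      then have q: "sqrt (B1 ?z v v) \<le> sqrt (M1 / m2) * sqrt (B2 ?z v v)"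
        "sqrt (B2 ?z v v) \<le> sqrt (M2 / m1) * sqrt (B1 ?z v v)"
        by (simp_all flip: real_sqrt_mult)
      have "0 \<le> m1 * (norm v)\<^sup>2" "0 \<le> m2 * (norm v)\<^sup>2" using 1 2 by simp_all
      with b1 b2 have nn: "0 \<le> sqrt (B1 ?z v v)" "0 \<le> sqrt (B2 ?z v v)" by simp_all
      have "sqrt (M1 / m2) \<le> B" "sqrt (M2 / m1) \<le> B" using 1 2 by (simp_all add: B_def)
      with nn have "sqrt (M1 / m2) * sqrt (B2 ?z v v) \<le> B * sqrt (B2 ?z v v)"
        "sqrt (M2 / m1) * sqrt (B1 ?z v v) \<le> B * sqrt (B1 ?z v v)" by (auto intro: mult_right_mono)
      with q show ?thesis unfolding n gz by linarith
    qed
    then show ?thesis using c(1) p(2) unfolding comparable_def by blast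
  qed
  ultimately show ?thesis using B by blast
qed

lemma comparable_on_compact:
  assumes g: "riemannian_metric A g" and V: "compactin X V" "V \<subseteq> U"
  shows "\<exists>B>0. \<forall>p\<in>V. comparable g B p"
proof -
  let ?\<O> = "{O'. openin X O' \<and> (\<exists>B>0. \<forall>p\<in>O'. comparable g B p)}"
  have "V \<subseteq> \<Union>?\<O>"
  proof
    fix p assume "p \<in> V"
    then have "p \<in> U" using V(2) by blast
    then obtain O' B where "openin X O'" "p \<in> O'" "0 < B" "\<forall>p\<in>O'. comparable g B p"
      using comparable_near[OF g] by metis
    then have "O' \<in> ?\<O>" by auto
    with \<open>p \<in> O'\<close> show "p \<in> \<Union>?\<O>" by (rule UnionI[rotated])
  qed
  then obtain \<F> where \<F>: "finite \<F>" "\<F> \<subseteq> ?\<O>" "V \<subseteq> \<Union>\<F>"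
    using compactinD[OF V(1), of ?\<O>] by (metis (mono_tags, lifting) mem_Collect_eq)
  then have "\<forall>O'\<in>\<F>. \<exists>B>0. \<forall>p\<in>O'. comparable g B p" by blast
  then obtain b where b: "\<And>O'. O' \<in> \<F> \<Longrightarrow> 0 < b O'" "\<And>O' p. O' \<in> \<F> \<Longrightarrow> p \<in> O' \<Longrightarrow> comparable g (b O') p"
    by metis
  define B where "B = 1 + sum b \<F>"
  have b_le: "b O' \<le> B" if "O' \<in> \<F>" for O'
  proof -
    have "b O' \<le> sum b \<F>"
      by (rule member_le_sum[OF that _ \<F>(1)]) (use b(1) less_imp_le in blast)
    then show ?thesis by (simp add: B_def)
  qed
  have "0 \<le> sum b \<F>" using b(1) by (meson less_imp_le sum_nonneg)
  then have "0 < B" by (simp add: B_def)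
  moreover have "comparable g B p" if pV: "p \<in> V" for p
  proof -
    obtain O' where "O' \<in> \<F>" "p \<in> O'" using \<F>(3) pV by blast
    then show ?thesis using comparable_mono[OF b(2) b_le b(1)] by blast
  qed
  ultimately show ?thesis by blast
qed

end

section \<open>Bounds for the parametrization of one simplex\<close>

context affine_simplex begin

abbreviation "stretch v \<equiv> L2_set (\<lambda>j. F v j - F 0 j) {..<k}"

text \<open>The comparison at \<open>param x\<close> is available in some chart \<open>c0\<close>. There \<open>d\<phi>\<close> maps the tangent vector to
  the image of \<open>w\<close> under the linear part of \<open>F\<close>, which does not mention the chart, and the
  transformation law of \<open>g\<close> carries its norm to the chart \<open>c\<close>.\<close>

lemma comparable_tangent_map:
  fixes w :: "real ^ 'n"
  assumes g: "riemannian_metric A g" and B: "comparable g B (param x)" and x: "x \<in> std"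
    and c: "c \<in> A" "param x \<in> cdom c"
  defines "v \<equiv> tangent_map c std param x w"
  shows "stretch w \<le> B * sqrt (g c (param x) v v)" and "sqrt (g c (param x) v v) \<le> B * stretch w"
proof -
  obtain c0 where c0: "c0 \<in> A" "param x \<in> cdom c0"
    and *: "\<And>v. dphi_norm c0 (param x) v \<le> B * sqrt (g c0 (param x) v v) \<and> sqrt (g c0 (param x) v v) \<le> B * dphi_norm c0 (param x) v"
    using B unfolding comparable_def by blast
  let ?v0 = "tangent_map c0 std param x w"
  have "dphi_norm c0 (param x) ?v0 = stretch w"
    unfolding dphi_norm_def by (intro L2_set_cong refl dphi_tangent_map[OF c0(1) x c0(2)]) simp
  moreover have "v = chart_change c0 c (param x) ?v0"
    unfolding v_def tangent_map_chart_change[OF param_smooth c0(1) c(1) x c0(2) c(2)] by simp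
  then have "g c (param x) v v = g c0 (param x) ?v0 ?v0"
    using g c0 c unfolding riemannian_metric_def by blast
  ultimately show "stretch w \<le> B * sqrt (g c (param x) v v)" "sqrt (g c (param x) v v) \<le> B * stretch w"
    using *[of ?v0] by simp_all
qed

lemma param_pushed_euclidean_bounds:
  assumes g: "riemannian_metric A g" and B: "\<And>p. p \<in> T \<Longrightarrow> comparable g B p" and "0 < B" "0 < a" "0 < b"
    and ab: "\<And>v. a * norm v \<le> stretch v" "\<And>v. stretch v \<le> b * norm v"
    and p: "p \<in> T" and c: "c \<in> A" "p \<in> cdom c"
  shows "sqrt (g c p v v) \<le> B * b * sqrt (pushed_euclidean param T c p v v)"
    and "sqrt (pushed_euclidean param T c p v v) \<le> B / a * sqrt (g c p v v)"
proof -
  obtain x where x: "x \<in> std" "p = param x" using param_bij p unfolding bij_betw_def by blast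
  define w where "w = frechet_derivative (inv_into std param \<circ> cinv c) (at (cmap c p) within cmap c ` (T \<inter> cdom c)) v"
  have v: "tangent_map c std param x w = v"
    using simplex_diffeo_derivatives(2)[OF param_diffeo x(1) c(1)] c(2) unfolding x(2) w_def by (metis comp_apply id_apply)
  have pe: "sqrt (pushed_euclidean param T c p v v) = norm w"
    by (simp add: pushed_euclidean_def Let_def w_def norm_eq_sqrt_inner)
  have 1: "stretch w \<le> B * sqrt (g c p v v)" "sqrt (g c p v v) \<le> B * stretch w"
    using comparable_tangent_map[OF g B[OF p, unfolded x(2)] x(1) c(1) c(2)[unfolded x(2)], of w]
    unfolding v x(2)[symmetric] by auto
  have "B * stretch w \<le> B * (b * norm w)" using ab(2) \<open>0 < B\<close> by (simp add: mult_left_mono)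
  with 1 show "sqrt (g c p v v) \<le> B * b * sqrt (pushed_euclidean param T c p v v)" unfolding pe by simp
  have "a * norm w \<le> B * sqrt (g c p v v)" using ab(1)[of w] 1(1) by linarith
  then show "sqrt (pushed_euclidean param T c p v v) \<le> B / a * sqrt (g c p v v)"
    unfolding pe using \<open>0 < a\<close> by (simp add: field_simps)
qed

lemma flipped_displacement:
  "(F \<circ> simplex_flip i) v j - (F \<circ> simplex_flip i) 0 j = F (flip_linear i v) j - F 0 j"
  using linear_add[OF affine_into_functionals(1)[OF affine, where j = j], of "flip_linear i v" "axis i 1"]
  by (simp add: simplex_flip_def linear_0[OF linear_flip])

lemma flipped: "affine_simplex X A U k \<phi> T (F \<circ> simplex_flip i)"
proof unfold_locales
  show "affine_into k (F \<circ> simplex_flip i)"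
    unfolding affine_into_def
  proof
    show "range (F \<circ> simplex_flip i) \<subseteq> topspace (Euclidean_space k)"
      using affine unfolding affine_into_def by auto
    show "\<forall>j. linear (\<lambda>v. (F \<circ> simplex_flip i) v j - (F \<circ> simplex_flip i) 0 j)"
      unfolding flipped_displacement
      using linear_compose[OF linear_flip affine_into_functionals(1)[OF affine]] by (simp add: o_def)
  qed
  show "inj (F \<circ> simplex_flip i)"
    by (intro inj_compose F_inj inj_on_inverseI[of _ "simplex_flip i"] simplex_flip_involution)
  show "(F \<circ> simplex_flip i) ` std = \<phi> ` T"
    by (simp only: image_comp[symmetric] simplex_flip_std_simplex F_image)
qed (rule TU)

lemma flipped_stretch:
  "L2_set (\<lambda>j. (F \<circ> simplex_flip i) v j - (F \<circ> simplex_flip i) 0 j) {..<k} = stretch (flip_linear i v)"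
  by (simp only: flipped_displacement)

lemma tangent_map_flip:
  assumes c: "c \<in> A" and x: "x \<in> std" "param (simplex_flip i x) \<in> cdom c"
  shows "tangent_map c std (param \<circ> simplex_flip i) x = tangent_map c std param (simplex_flip i x) \<circ> flip_linear i"
proof -
  have fx: "simplex_flip i x \<in> std" using x(1) simplex_flip_std_simplex by blast
  interpret fl: affine_simplex X A U k \<phi> T "F \<circ> simplex_flip i" by (rule flipped)
  have "((cmap c \<circ> param) has_derivative tangent_map c std param (simplex_flip i x))
      (at (simplex_flip i x) within simplex_flip i ` std)"
    using tangent_map_has_derivative[OF param_smooth c fx x(2)] simplex_flip_std_simplex by metis
  from diff_chain_within[OF simplex_flip_has_derivative this]
  have "((cmap c \<circ> (param \<circ> simplex_flip i)) has_derivative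
      tangent_map c std param (simplex_flip i x) \<circ> flip_linear i) (at x within std)"
    by (simp only: o_assoc)
  moreover have "((cmap c \<circ> (param \<circ> simplex_flip i)) has_derivative
      tangent_map c std (param \<circ> simplex_flip i) x) (at x within std)"
    using tangent_map_has_derivative[OF fl.param_smooth c x(1)] x(2) by (simp only: o_assoc comp_apply)
  ultimately show ?thesis using has_derivative_unique_std_simplex x(1) by blast
qed

lemma param_oriented: "oriented_diffeo X A param T \<or> oriented_diffeo X A (param \<circ> simplex_flip i) T"
proof -
  interpret fl: affine_simplex X A U k \<phi> T "F \<circ> simplex_flip i" by (rule flipped)
  have inj: "inj (tangent_map c std param x)" if "c \<in> A" "x \<in> std" "param x \<in> cdom c" for c x
    using simplex_diffeo_derivatives(1)[OF param_diffeo that(2,1,3)] by (metis inj_on_id inj_on_imageI2)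
  have od: "oriented_diffeo X A f T" if "simplex_diffeo f T"
    "\<forall>x\<in>std. \<forall>c\<in>A. f x \<in> cdom c \<longrightarrow> 0 < det (matrix (tangent_map c std f x))" for f
    using that unfolding oriented_diffeo_def simplex_diffeo_def by blast
  have "(\<forall>x\<in>std. \<forall>c\<in>A. param x \<in> cdom c \<longrightarrow> 0 < det (matrix (tangent_map c std param x))) \<or>
      (\<forall>x\<in>std. \<forall>c\<in>A. param x \<in> cdom c \<longrightarrow> det (matrix (tangent_map c std param x)) < 0)"
    by (rule tangent_map_orientation[OF param_smooth]) (rule inj)
  then show ?thesis
  proof (elim disjE)
    assume negative: "\<forall>x\<in>std. \<forall>c\<in>A. param x \<in> cdom c \<longrightarrow> det (matrix (tangent_map c std param x)) < 0"
    have "0 < det (matrix (tangent_map c std (param \<circ> simplex_flip i) x))"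
      if x: "x \<in> std" "c \<in> A" "(param \<circ> simplex_flip i) x \<in> cdom c" for x c
    proof -
      have fx: "simplex_flip i x \<in> std" using x(1) simplex_flip_std_simplex by blast
      have px: "param (simplex_flip i x) \<in> cdom c" using x(3) by simp
      show ?thesis
        using negative[rule_format, OF fx x(2) px]
        unfolding tangent_map_flip[OF x(2,1) px]
          matrix_compose[OF linear_flip tangent_map_linear[OF param_smooth x(2) fx px]]
        by (simp add: det_mul det_flip_linear)
    qed
    moreover have "simplex_diffeo (param \<circ> simplex_flip i) T"
      using fl.param_diffeo by (simp only: o_assoc)
    ultimately show ?thesis using od by blast
  next
    assume "\<forall>x\<in>std. \<forall>c\<in>A. param x \<in> cdom c \<longrightarrow> 0 < det (matrix (tangent_map c std param x))"
    then show ?thesis using od[OF param_diffeo] by blast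
  qed
qed

text \<open>The involution changes \<open>a\<close> and \<open>b\<close> by at most the factor \<open>R\<close> because it is its own inverse. The
  bounds are stated with \<open>a / R\<close> and \<open>b R\<close> in either case, so that they do not depend on the
  orientation of \<open>T\<close>.\<close>

lemma oriented_parametrization:
  fixes i :: 'n
  assumes g: "riemannian_metric A g" and B: "\<And>p. p \<in> T \<Longrightarrow> comparable g B p" and "0 < B" "0 < a" "0 < b"
    and ab: "\<And>v. a * norm v \<le> stretch v" "\<And>v. stretch v \<le> b * norm v"
    and R: "1 \<le> R" "\<And>v. norm (flip_linear i v) \<le> R * norm v"
  shows "\<exists>f. oriented_diffeo X A f T \<and> (\<forall>c\<in>A. \<forall>p\<in>T \<inter> cdom c. \<forall>v.
     sqrt (g c p v v) \<le> B * (b * R) * sqrt (pushed_euclidean f T c p v v) \<and>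
     sqrt (pushed_euclidean f T c p v v) \<le> B / (a / R) * sqrt (g c p v v))"
proof -
  interpret fl: affine_simplex X A U k \<phi> T "F \<circ> simplex_flip i" by (rule flipped)
  have pos: "0 < a / R" "0 < b * R" using \<open>0 < a\<close> \<open>0 < b\<close> R(1) by simp_all
  have 1: "a / R * norm v \<le> stretch v" "stretch v \<le> b * R * norm v" for v
  proof -
    have "a / R \<le> a" "b \<le> b * R" using \<open>0 < a\<close> \<open>0 < b\<close> R(1) by (simp_all add: field_simps)
    then have "a / R * norm v \<le> a * norm v" "b * norm v \<le> b * R * norm v"
      by (blast intro: mult_right_mono norm_ge_zero)+
    with ab[of v] show "a / R * norm v \<le> stretch v" "stretch v \<le> b * R * norm v" by linarith+
  qed
  have 2: "a / R * norm v \<le> fl.stretch v" "fl.stretch v \<le> b * R * norm v" for v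
  proof -
    have "norm v \<le> R * norm (flip_linear i v)" using R(2)[of "flip_linear i v"] by (simp add: flip_linear_involution)
    then have "a / R * norm v \<le> a / R * (R * norm (flip_linear i v))" using pos by (intro mult_left_mono) auto
    moreover have "b * norm (flip_linear i v) \<le> b * (R * norm v)" using R(2)[of v] \<open>0 < b\<close> by simp
    ultimately show "a / R * norm v \<le> fl.stretch v" "fl.stretch v \<le> b * R * norm v"
      unfolding flipped_stretch using ab[of "flip_linear i v"] R(1) by simp_all
  qed
  have fleq: "param \<circ> simplex_flip i = fl.param" by (simp only: o_assoc)
  from param_oriented[of i] show ?thesis
  proof
    assume "oriented_diffeo X A param T"
    moreover have "sqrt (g c p v v) \<le> B * (b * R) * sqrt (pushed_euclidean (param) T c p v v) \<and>
        sqrt (pushed_euclidean (param) T c p v v) \<le> B / (a / R) * sqrt (g c p v v)"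
      if "c \<in> A" "p \<in> T \<inter> cdom c" for c p v
      using that
      by (intro conjI param_pushed_euclidean_bounds[OF g B \<open>0 < B\<close> pos 1]) auto
    ultimately show ?thesis by blast
  next
    assume "oriented_diffeo X A (param \<circ> simplex_flip i) T"
    moreover have "sqrt (g c p v v) \<le> B * (b * R) * sqrt (pushed_euclidean (param \<circ> simplex_flip i) T c p v v) \<and>
        sqrt (pushed_euclidean (param \<circ> simplex_flip i) T c p v v) \<le> B / (a / R) * sqrt (g c p v v)"
      if "c \<in> A" "p \<in> T \<inter> cdom c" for c p v
      using that unfolding fleq
      by (intro conjI fl.param_pushed_euclidean_bounds[OF g B \<open>0 < B\<close> pos 2]) auto
    ultimately show ?thesis by blast
  qed
qed

end

section \<open>Comparison constants\<close>

text \<open>The maximum with \<open>0\<close> covers fields of forms that are not positive definite, for which the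
  quotient of square roots can be negative; the essential supremum only sees its positive part.\<close>

lemma comparison_const_mono:
  fixes A :: "('a, 'n::finite) chart set" and \<kappa> :: real
  assumes "T \<subseteq> M" and \<kappa>: "0 < \<kappa>"
    and le: "\<And>c p v. c \<in> A \<Longrightarrow> p \<in> T \<Longrightarrow> p \<in> cdom c \<Longrightarrow> v \<noteq> 0 \<Longrightarrow>
      sqrt (g1 c p v v) / sqrt (g2 c p v v) \<le> \<kappa> * max 0 (sqrt (h1 c p v v) / sqrt (h2 c p v v))"
  shows "comparison_const A g1 g2 T \<le> ennreal \<kappa> * comparison_const A h1 h2 M"
proof -
  define bad where "bad g1 g2 \<Omega> b = {p\<in>\<Omega>. \<exists>c\<in>A. p \<in> cdom c \<and>
      (\<exists>v. v \<noteq> 0 \<and> b < ennreal (sqrt (g1 c p v v) / sqrt (g2 c p v v)))}"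
    for g1 g2 :: "('a, 'n) form_field" and \<Omega> b
  have cc: "comparison_const A g1 g2 \<Omega> = Inf {b. null_set A (bad g1 g2 \<Omega> b)}"
    for g1 g2 :: "('a, 'n) form_field" and \<Omega>
    by (simp add: comparison_const_def bad_def)
  have "comparison_const A g1 g2 T / ennreal \<kappa> \<le> comparison_const A h1 h2 M"
    unfolding cc[of h1]
  proof (rule Inf_greatest)
    fix b assume "b \<in> {b. null_set A (bad h1 h2 M b)}"
    moreover have "bad g1 g2 T (ennreal \<kappa> * b) \<subseteq> bad h1 h2 M b"
    proof
      fix p assume "p \<in> bad g1 g2 T (ennreal \<kappa> * b)"
      then obtain c v where p: "p \<in> T" "c \<in> A" "p \<in> cdom c" "v \<noteq> 0"
        and b: "ennreal \<kappa> * b < ennreal (sqrt (g1 c p v v) / sqrt (g2 c p v v))"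
        unfolding bad_def by blast
      have "ennreal (sqrt (g1 c p v v) / sqrt (g2 c p v v)) \<le> ennreal (\<kappa> * max 0 (sqrt (h1 c p v v) / sqrt (h2 c p v v)))"
        using le[OF p(2,1,3,4)] by (rule ennreal_leI)
      also have "\<dots> = ennreal \<kappa> * ennreal (sqrt (h1 c p v v) / sqrt (h2 c p v v))"
        using \<kappa> by (simp add: ennreal_mult max_def ennreal_neg)
      finally have "ennreal \<kappa> * b < ennreal \<kappa> * ennreal (sqrt (h1 c p v v) / sqrt (h2 c p v v))"
        using b by (rule less_le_trans[rotated])
      then have "b < ennreal (sqrt (h1 c p v v) / sqrt (h2 c p v v))"
        by (meson mult_left_mono not_le zero_le)
      with p \<open>T \<subseteq> M\<close> show "p \<in> bad h1 h2 M b" unfolding bad_def by blast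
    qed
    ultimately have "null_set A (bad g1 g2 T (ennreal \<kappa> * b))"
      unfolding null_set_def by (blast intro: negligible_subset)
    then have "comparison_const A g1 g2 T \<le> ennreal \<kappa> * b"
      unfolding cc[of g1] by (intro Inf_lower) simp
    then show "comparison_const A g1 g2 T / ennreal \<kappa> \<le> b"
      using \<kappa> by (simp add: divide_le_posI_ennreal)
  qed
  then have "ennreal \<kappa> * (comparison_const A g1 g2 T / ennreal \<kappa>) \<le> ennreal \<kappa> * comparison_const A h1 h2 M"
    by (rule mult_left_mono) simp
  moreover have "ennreal \<kappa> * (comparison_const A g1 g2 T / ennreal \<kappa>) = comparison_const A g1 g2 T * ennreal \<kappa> / ennreal \<kappa>"
    by (simp only: ennreal_times_divide mult.commute)
  moreover have "\<dots> = comparison_const A g1 g2 T"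
    by (rule ennreal_mult_divide_eq) (use \<kappa> in auto)
  ultimately show ?thesis by simp
qed

text \<open>If the norms of \<open>d\<close> and \<open>g\<close> are equivalent everywhere on \<open>T\<close>, then \<open>g\<close> may be replaced by \<open>d\<close> at
  the price of the two constants. Multiplying by finite constants only, rather than by comparison
  constants of \<open>d\<close> and \<open>g\<close>, avoids the product \<open>0 \<cdot> \<infinity>\<close>.\<close>

lemma comparison_const_equivalent_metrics:
  fixes A :: "('a, 'n::finite) chart set" and g d G :: "('a, 'n) form_field" and \<kappa>1 \<kappa>2 :: real
  assumes TM: "T \<subseteq> M" and \<kappa>: "0 < \<kappa>1" "0 < \<kappa>2"
    and g: "\<And>c p v. c \<in> A \<Longrightarrow> p \<in> T \<Longrightarrow> p \<in> cdom c \<Longrightarrow> v \<noteq> 0 \<Longrightarrow> 0 < g c p v v"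
    and 1: "\<And>c p v. c \<in> A \<Longrightarrow> p \<in> T \<Longrightarrow> p \<in> cdom c \<Longrightarrow> sqrt (g c p v v) \<le> \<kappa>1 * sqrt (d c p v v)"
    and 2: "\<And>c p v. c \<in> A \<Longrightarrow> p \<in> T \<Longrightarrow> p \<in> cdom c \<Longrightarrow> sqrt (d c p v v) \<le> \<kappa>2 * sqrt (g c p v v)"
  shows "comparison_const A G d T * comparison_const A d G T \<le>
     ennreal (\<kappa>1 * \<kappa>2) * (comparison_const A g G M * comparison_const A G g M)"
proof -
  have "comparison_const A G d T \<le> ennreal \<kappa>1 * comparison_const A G g M"
  proof (rule comparison_const_mono[OF TM \<kappa>(1)])
    fix c p and v :: "real ^ 'n" assume p: "c \<in> A" "p \<in> T" "p \<in> cdom c" "v \<noteq> 0"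
    have gp: "0 < sqrt (g c p v v)" using g[OF p] by simp
    with 1[OF p(1-3), of v] \<kappa>(1) have dp: "0 < sqrt (d c p v v)"
      by (smt (verit) zero_less_mult_pos)
    show "sqrt (G c p v v) / sqrt (d c p v v) \<le> \<kappa>1 * max 0 (sqrt (G c p v v) / sqrt (g c p v v))"
    proof (cases "0 \<le> sqrt (G c p v v)")
      case True
      have "sqrt (G c p v v) * sqrt (g c p v v) \<le> sqrt (G c p v v) * (\<kappa>1 * sqrt (d c p v v))"
        using 1[OF p(1-3), of v] True by (rule mult_left_mono)
      then show ?thesis using True gp dp by (simp add: max_def field_simps)
    next
      case False
      then have "sqrt (G c p v v) / sqrt (d c p v v) \<le> 0" using dp by (simp add: divide_nonpos_pos)
      also have "0 \<le> \<kappa>1 * max 0 (sqrt (G c p v v) / sqrt (g c p v v))" using \<kappa>(1) by simp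
      finally show ?thesis .
    qed
  qed
  moreover have "comparison_const A d G T \<le> ennreal \<kappa>2 * comparison_const A g G M"
  proof (rule comparison_const_mono[OF TM \<kappa>(2)])
    fix c p and v :: "real ^ 'n" assume p: "c \<in> A" "p \<in> T" "p \<in> cdom c" "v \<noteq> 0"
    have gp: "0 < sqrt (g c p v v)" using g[OF p] by simp
    with 1[OF p(1-3), of v] \<kappa>(1) have dp: "0 < sqrt (d c p v v)"
      by (smt (verit) zero_less_mult_pos)
    show "sqrt (d c p v v) / sqrt (G c p v v) \<le> \<kappa>2 * max 0 (sqrt (g c p v v) / sqrt (G c p v v))"
    proof (cases "0 < sqrt (G c p v v)")
      case True
      have "sqrt (d c p v v) / sqrt (G c p v v) \<le> \<kappa>2 * sqrt (g c p v v) / sqrt (G c p v v)"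
        using 2[OF p(1-3), of v] True by (intro divide_right_mono) auto
      then show ?thesis using True gp by (simp add: max_def)
    next
      case False
      then have "sqrt (d c p v v) / sqrt (G c p v v) \<le> 0" using dp by (simp add: divide_nonneg_nonpos)
      also have "0 \<le> \<kappa>2 * max 0 (sqrt (g c p v v) / sqrt (G c p v v))" using \<kappa>(2) by simp
      finally show ?thesis .
    qed
  qed
  ultimately have "comparison_const A G d T * comparison_const A d G T \<le>
      (ennreal \<kappa>1 * comparison_const A G g M) * (ennreal \<kappa>2 * comparison_const A g G M)"
    by (rule mult_mono) simp_all
  also have "\<dots> = ennreal (\<kappa>1 * \<kappa>2) * (comparison_const A g G M * comparison_const A G g M)"
    using \<kappa> by (simp add: ennreal_mult mult_ac)
  finally show ?thesis .
qed

section \<open>Uniform shape-regularity\<close>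

context embedded_open begin

text \<open>All simplices in one closed set \<open>V\<close> at once: \<open>L\<close> collects the compactness constant of \<open>V\<close>, the
  distortion bound \<open>K\<close> and the norm of the involution; none of them depends on \<open>T\<close> or \<open>F\<close>.\<close>

lemma uniform_parametrization:
  assumes g: "riemannian_metric A g" and V: "compactin X V" "V \<subseteq> U" and "0 < K"
  shows "\<exists>L>0. \<forall>T F. T \<subseteq> V \<and> affine_into k F \<and> inj F \<and> F ` std = \<phi> ` T \<and>
      (SUP v\<in>- {0}. linear_stretch k F v) / (INF w\<in>- {0}. linear_stretch k F w) \<le> K \<longrightarrow>
      (\<exists>f. oriented_diffeo X A f T \<and> (\<forall>G.
        comparison_const A G (pushed_euclidean f T) T * comparison_const A (pushed_euclidean f T) G T \<le>
        ennreal L * (comparison_const A g G (topspace X) * comparison_const A G g (topspace X))))"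
proof -
  obtain B where B: "0 < B" "\<And>p. p \<in> V \<Longrightarrow> comparable g B p"
    using comparable_on_compact[OF g V] by blast
  define i :: 'n where "i = undefined"
  obtain R0 where R0: "0 < R0" "\<And>v. norm (flip_linear i v) \<le> R0 * norm v"
    using linear_bounded_pos[OF linear_flip] by blast
  define R where "R = max 1 R0"
  have R: "1 \<le> R" "norm (flip_linear i v) \<le> R * norm v" for v
    using R0(2)[of v] mult_right_mono[of R0 R "norm v"] by (auto simp: R_def)
  define L where "L = B\<^sup>2 * R\<^sup>2 * K"
  have L: "0 < L" using B(1) R(1) \<open>0 < K\<close> by (simp add: L_def)
  have "\<exists>f. oriented_diffeo X A f T \<and> (\<forall>G.
        comparison_const A G (pushed_euclidean f T) T * comparison_const A (pushed_euclidean f T) G T \<le>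
        ennreal L * (comparison_const A g G (topspace X) * comparison_const A G g (topspace X)))"
    if TV: "T \<subseteq> V" and F: "affine_into k F" "inj F" "F ` std = \<phi> ` T"
      "(SUP v\<in>- {0}. linear_stretch k F v) / (INF w\<in>- {0}. linear_stretch k F w) \<le> K" for T F
  proof -
    interpret affine_simplex X A U k \<phi> T F
      by unfold_locales (use TV V(2) F in auto)
    obtain a b where ab: "0 < a" "0 < b" "b \<le> K * a" "\<And>v. a * norm v \<le> stretch v" "\<And>v. stretch v \<le> b * norm v"
      using affine_stretch_bounds[OF F(1,2,4)] by blast
    have BT: "comparable g B p" if "p \<in> T" for p using B(2) TV that by blast
    obtain f where f: "oriented_diffeo X A f T" and
      fb: "\<And>c p v. c \<in> A \<Longrightarrow> p \<in> T \<Longrightarrow> p \<in> cdom c \<Longrightarrow>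
         sqrt (g c p v v) \<le> B * (b * R) * sqrt (pushed_euclidean f T c p v v)"
        "\<And>c p v. c \<in> A \<Longrightarrow> p \<in> T \<Longrightarrow> p \<in> cdom c \<Longrightarrow>
         sqrt (pushed_euclidean f T c p v v) \<le> B / (a / R) * sqrt (g c p v v)"
      using oriented_parametrization[OF g BT B(1) ab(1,2,4,5) R] by blast
    have TX: "T \<subseteq> topspace X" using TU openin_subset[OF U] by blast
    have gpos: "0 < g c p v v" if "c \<in> A" "p \<in> T" "p \<in> cdom c" "v \<noteq> 0" for c p v
      using g that unfolding riemannian_metric_def inner_product_on_def by blast
    have pos: "0 < B * (b * R)" "0 < B / (a / R)" using B(1) ab(1,2) R(1) by simp_all
    \<comment> \<open>The size of the simplex cancels: only the quotient of \<open>b\<close> and \<open>a\<close> is left.\<close>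
    have "B * (b * R) * (B / (a / R)) = B\<^sup>2 * R\<^sup>2 * (b / a)" by (simp add: power2_eq_square)
    also have "\<dots> \<le> L"
      unfolding L_def using ab(1,3) by (intro mult_left_mono) (auto simp: divide_le_eq)
    finally have "ennreal (B * (b * R) * (B / (a / R))) \<le> ennreal L" by (rule ennreal_leI)
    note constants = this
    have "comparison_const A G (pushed_euclidean f T) T * comparison_const A (pushed_euclidean f T) G T \<le>
        ennreal L * (comparison_const A g G (topspace X) * comparison_const A G g (topspace X))" for G
    proof -
      have "comparison_const A G (pushed_euclidean f T) T * comparison_const A (pushed_euclidean f T) G T \<le>
          ennreal (B * (b * R) * (B / (a / R))) *
          (comparison_const A g G (topspace X) * comparison_const A G g (topspace X))"
        by (rule comparison_const_equivalent_metrics[OF TX pos]) (rule gpos fb; assumption)+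
      also have "\<dots> \<le> ennreal L * (comparison_const A g G (topspace X) * comparison_const A G g (topspace X))"
        by (rule mult_right_mono[OF constants]) simp
      finally show ?thesis .
    qed
    with f show ?thesis by blast
  qed
  with L show ?thesis by blast
qed

end

theorem lemma10:
  fixes X :: "'a topology" and A :: "('a, 'n::finite) chart set" and g :: "('a, 'n) form_field"
    and N :: nat and U V :: "nat \<Rightarrow> 'a set" and k :: "nat \<Rightarrow> nat"
    and \<phi> :: "nat \<Rightarrow> 'a \<Rightarrow> nat \<Rightarrow> real"
    and S :: "real set" and \<T> :: "real \<Rightarrow> 'a set set"
    and G :: "real \<Rightarrow> 'a set \<Rightarrow> ('a, 'n) form_field"
    and \<iota> :: "real \<Rightarrow> 'a set \<Rightarrow> nat" and F :: "real \<Rightarrow> 'a set \<Rightarrow> real ^ 'n \<Rightarrow> nat \<Rightarrow> real"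
  assumes "oriented_manifold X A" and "compact_space X" and "riemannian_metric A g"
    and "\<And>i. i \<in> {1..N} \<Longrightarrow> openin X (U i)" and "(\<Union>i\<in>{1..N}. U i) = topspace X"
    and "\<And>i. i \<in> {1..N} \<Longrightarrow> smooth_embedding X A (U i) (k i) (\<phi> i)"
    and "\<And>i. i \<in> {1..N} \<Longrightarrow> closedin X (V i) \<and> V i \<subseteq> U i" and "(\<Union>i\<in>{1..N}. V i) = topspace X"
    and "regge_family S (\<lambda>_. X) (\<lambda>_. A) \<T> G"
    and "\<exists>C<\<infinity>. \<forall>h\<in>S.
           comparison_const A g (regge_field X A (\<T> h) (G h)) (topspace X) *
           comparison_const A (regge_field X A (\<T> h) (G h)) g (topspace X) \<le> C"
    and "\<And>h T. h \<in> S \<Longrightarrow> T \<in> top_simplices X A (\<T> h) \<Longrightarrow> \<iota> h T \<in> {1..N} \<and> T \<subseteq> V (\<iota> h T)"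
    and "\<And>h T. h \<in> S \<Longrightarrow> T \<in> top_simplices X A (\<T> h) \<Longrightarrow>
           affine_into (k (\<iota> h T)) (F h T) \<and> inj (F h T) \<and>
           F h T ` std_simplex UNIV = \<phi> (\<iota> h T) ` T"
    and "\<exists>K>0. \<forall>h\<in>S. \<forall>T\<in>top_simplices X A (\<T> h).
           (SUP v\<in>- {0}. linear_stretch (k (\<iota> h T)) (F h T) v) /
           (INF w\<in>- {0}. linear_stretch (k (\<iota> h T)) (F h T) w) \<le> K"
  shows "riemannian_shape_regular S (\<lambda>_. X) (\<lambda>_. A) \<T> G"
proof -
  let ?M = "topspace X" and ?R = "\<lambda>h. regge_field X A (\<T> h) (G h)"
  interpret atlas_manifold X A by unfold_locales fact
  obtain C where C: "C < \<infinity>"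
    "\<And>h. h \<in> S \<Longrightarrow> comparison_const A g (?R h) ?M * comparison_const A (?R h) g ?M \<le> C"
    using assms(10) by blast
  obtain K where K: "0 < K" "\<And>h T. h \<in> S \<Longrightarrow> T \<in> top_simplices X A (\<T> h) \<Longrightarrow>
      (SUP v\<in>- {0}. linear_stretch (k (\<iota> h T)) (F h T) v) /
      (INF w\<in>- {0}. linear_stretch (k (\<iota> h T)) (F h T) w) \<le> K"
    using assms(13) by blast
  have "\<exists>L>0. \<forall>T F. T \<subseteq> V i \<and> affine_into (k i) F \<and> inj F \<and> F ` std = \<phi> i ` T \<and>
      (SUP v\<in>- {0}. linear_stretch (k i) F v) / (INF w\<in>- {0}. linear_stretch (k i) F w) \<le> K \<longrightarrow>
      (\<exists>f. oriented_diffeo X A f T \<and> (\<forall>G.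
        comparison_const A G (pushed_euclidean f T) T * comparison_const A (pushed_euclidean f T) G T \<le>
        ennreal L * (comparison_const A g G ?M * comparison_const A G g ?M)))" if i: "i \<in> {1..N}" for i
  proof -
    interpret embedded_open X A "U i" "k i" "\<phi> i"
      by unfold_locales (use assms(4,6) i in auto)
    have "compactin X (V i)" using assms(2,7) i closedin_compact_space by blast
    moreover have "V i \<subseteq> U i" using assms(7) i by blast
    ultimately show ?thesis by (rule uniform_parametrization[OF assms(3) _ _ K(1)])
  qed
  then obtain L where L: "\<And>i. i \<in> {1..N} \<Longrightarrow> 0 < L i"
    "\<And>i T F. i \<in> {1..N} \<Longrightarrow> T \<subseteq> V i \<Longrightarrow> affine_into (k i) F \<Longrightarrow> inj F \<Longrightarrow> F ` std = \<phi> i ` T \<Longrightarrow>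
      (SUP v\<in>- {0}. linear_stretch (k i) F v) / (INF w\<in>- {0}. linear_stretch (k i) F w) \<le> K \<Longrightarrow>
      \<exists>f. oriented_diffeo X A f T \<and> (\<forall>G.
        comparison_const A G (pushed_euclidean f T) T * comparison_const A (pushed_euclidean f T) G T \<le>
        ennreal (L i) * (comparison_const A g G ?M * comparison_const A G g ?M))"
    by metis
  \<comment> \<open>The summand \<open>1\<close> makes the bound positive also if \<open>C = 0\<close> or \<open>N = 0\<close>.\<close>
  define K' where "K' = ennreal (sum L {1..N}) * C + 1"
  have K': "0 < K'" "K' < \<infinity>"
    using C(1) by (auto simp: K'_def ennreal_mult_less_top add_pos_pos intro: add_nonneg_pos)
  have "\<exists>f. oriented_diffeo X A f T \<and>
      comparison_const A (?R h) (pushed_euclidean f T) T * comparison_const A (pushed_euclidean f T) (?R h) T \<le> K'"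
    if hT: "h \<in> S" "T \<in> top_simplices X A (\<T> h)" for h T
  proof -
    let ?i = "\<iota> h T"
    have i: "?i \<in> {1..N}" "T \<subseteq> V ?i" using assms(11)[OF hT] by auto
    obtain f where f: "oriented_diffeo X A f T" and
      le: "\<And>G. comparison_const A G (pushed_euclidean f T) T * comparison_const A (pushed_euclidean f T) G T \<le>
        ennreal (L ?i) * (comparison_const A g G ?M * comparison_const A G g ?M)"
      using L(2)[OF i, of "F h T"] assms(12)[OF hT] K(2)[OF hT] by blast
    have "L ?i \<le> sum L {1..N}"
      by (rule member_le_sum[OF i(1)]) (use L(1) less_imp_le in blast, simp)
    then have "ennreal (L ?i) * (comparison_const A g (?R h) ?M * comparison_const A (?R h) g ?M)
        \<le> ennreal (sum L {1..N}) * C"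
      using C(2)[OF hT(1)] by (intro mult_mono ennreal_leI) auto
    also have "\<dots> \<le> K'" by (simp add: K'_def)
    finally show ?thesis using f le[of "?R h"] by (meson order_trans)
  qed
  then obtain f where "\<And>h T. h \<in> S \<Longrightarrow> T \<in> top_simplices X A (\<T> h) \<Longrightarrow> oriented_diffeo X A (f h T) T \<and>
      comparison_const A (?R h) (pushed_euclidean (f h T) T) T *
      comparison_const A (pushed_euclidean (f h T) T) (?R h) T \<le> K'"
    by metis
  with K' assms(9) show ?thesis unfolding riemannian_shape_regular_def by blast
qed

end
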